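(* Let $M$ be a finite monoid. The following are equivalent: (1) $M$ is totally ordered; (2) for every edge selector $P\subseteq M^3$ and every $d\in\mathbb{N}$, the class of (unlabelled) downcastings $\{\mathrm{dc}(\mathcal{G}):\mathcal{G}\in\mathrm{Reg}_d\}$ is $\infty$-well-quasi-ordered for the induced subgraph relation; (3) for every edge selector $P\subseteq M^3$ and every $d\in\mathbb{N}$, that class is $2$-well-quasi-ordered.
   Context: For $m$ in a monoid $M$, $J(m)=\{xmy:x,y\in M\}$; $M$ is totally ordered if for all $a,b$, $J(ab)=J(a)$ or $J(ab)=J(b)$. $e\in M$ is idempotent if $e^2=e$. A monoid-labelled graph over $M$ is a tuple $\mathcal{G}=(m,V,E,\lambda)$ with $m\in M$ (the evaluation of $\mathcal{G}$), $V$ a finite vertex set, $E\colon V\times V\to(M^2\to\{\top,\bot\})$ and $\lambda\colon V\to M^2$ such that $\lambda(x)=(l_x,r_x)$ satisfies $l_xr_x=m$ for all $x$. The downcasting $\mathrm{dc}(\mathcal{G})$ is the graph on $V$ in which distinct $x,y$ are adjacent iff $E(x,y)(1_M,1_M)=\top$. An edge selector is a set $P\subseteq M^3$. The binary product (w.r.t. $P$) $\mathcal{G}_1\odot\mathcal{G}_2$ of $\mathcal{G}_i=(m_i,V_i,E_i,\lambda_i)$ has vertex set $V_1\sqcup V_2$, evaluation $m_1m_2$, label $(l_x,r_xm_2)$ for $x\in V_1$ with $\lambda_1(x)=(l_x,r_x)$, label $(m_1l_y,r_y)$ for $y\in V_2$ with $\lambda_2(y)=(l_y,r_y)$, edge function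 $E_1(x,x')(s,m_2t)$ on $V_1$, $E_2(y,y')(sm_1,t)$ on $V_2$, and for $x\in V_1,y\in V_2$: $E(x,y)(s,t)=E(y,x)(s,t)=\top$ iff $(sl_x,r_xl_y,r_yt)\in P$. This product is associative. For a finite nonempty sequence $\mathcal{G}_1,\dots,\mathcal{G}_n$ all evaluating to the same idempotent $e$, the idempotent product is $\mathcal{G}_1\odot\cdots\odot\mathcal{G}_n$. $\mathrm{Reg}_0$ is the class of monoid-labelled graphs with one vertex; $\mathrm{Reg}_{k+1}$ consists of all $\mathcal{G}_1\odot\mathcal{G}_2$ with $\mathcal{G}_1,\mathcal{G}_2\in\mathrm{Reg}_k$ and all idempotent products of finite nonempty sequences in $\mathrm{Reg}_k$ evaluating to a common idempotent. Graph embeddings are injective maps with $\{h(u),h(v)\}$ an edge iff $\{u,v\}$ is. A class $\mathcal{C}$ of graphs is $k$-well-quasi-ordered if for every finite $X$ with $|X|\le k$, the graphs in $\mathcal{C}$ with vertex labellings into $X$ are well-quasi-ordered by label-preserving embeddings; $\infty$-well-quasi-ordered if this holds for every finite $X$. *)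

theory Defs
  imports Main
begin

definition Jideal :: "'m::monoid_mult \<Rightarrow> 'm set" where
  "Jideal m = {x * m * y | x y. True}"

definition monoid_totally_ordered :: "('m::monoid_mult) itself \<Rightarrow> bool" where
  "monoid_totally_ordered (T :: 'm itself) \<longleftrightarrow>
     (\<forall>a b :: 'm. Jideal (a * b) = Jideal a \<or> Jideal (a * b) = Jideal b)"

text \<open>Vertices are named by boolean lists; the disjoint union of V1 and V2
  is realised as (False # V1) \<union> (True # V2).\<close>

type_synonym vname = "bool list"

record 'm mlgraph =
  meval :: 'm
  mverts :: "vname set"
  medge :: "vname \<Rightarrow> vname \<Rightarrow> 'm \<Rightarrow> 'm \<Rightarrow> bool"
  mlab :: "vname \<Rightarrow> 'm \<times> 'm"

definition mlg_wf :: "('m::monoid_mult) mlgraph \<Rightarrow> bool" where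
  "mlg_wf G \<longleftrightarrow> finite (mverts G) \<and>
     (\<forall>x\<in>mverts G. fst (mlab G x) * snd (mlab G x) = meval G)"

definition mlg_prod :: "('m::monoid_mult \<times> 'm \<times> 'm) set \<Rightarrow> 'm mlgraph \<Rightarrow> 'm mlgraph \<Rightarrow> 'm mlgraph" where
  "mlg_prod P G1 G2 =
     \<lparr> meval = meval G1 * meval G2,
       mverts = (Cons False) ` mverts G1 \<union> (Cons True) ` mverts G2,
       medge = (\<lambda>u v s t.
          case (u, v) of
            (False # x, False # x') \<Rightarrow> medge G1 x x' s (meval G2 * t)
          | (True # y, True # y') \<Rightarrow> medge G2 y y' (s * meval G1) t
          | (False # x, True # y) \<Rightarrow>
               (s * fst (mlab G1 x), snd (mlab G1 x) * fst (mlab G2 y), snd (mlab G2 y) * t) \<in> P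
          | (True # y, False # x) \<Rightarrow>
               (s * fst (mlab G1 x), snd (mlab G1 x) * fst (mlab G2 y), snd (mlab G2 y) * t) \<in> P
          | _ \<Rightarrow> False),
       mlab = (\<lambda>u. case u of
            False # x \<Rightarrow> (fst (mlab G1 x), snd (mlab G1 x) * meval G2)
          | True # y \<Rightarrow> (meval G1 * fst (mlab G2 y), snd (mlab G2 y))
          | [] \<Rightarrow> undefined) \<rparr>"

text \<open>Product of a nonempty list G1 \<odot> ... \<odot> Gn (the product is associative,
  so the bracketing is immaterial; we bracket to the left).\<close>

fun mlg_prod_list :: "('m::monoid_mult \<times> 'm \<times> 'm) set \<Rightarrow> 'm mlgraph list \<Rightarrow> 'm mlgraph" where
  "mlg_prod_list P [] = undefined"
| "mlg_prod_list P (G # Gs) = foldl (mlg_prod P) G Gs"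

fun Reg :: "('m::monoid_mult \<times> 'm \<times> 'm) set \<Rightarrow> nat \<Rightarrow> 'm mlgraph set" where
  "Reg P 0 = {G. mlg_wf G \<and> card (mverts G) = 1}"
| "Reg P (Suc k) =
     {mlg_prod P G1 G2 | G1 G2. G1 \<in> Reg P k \<and> G2 \<in> Reg P k}
   \<union> {mlg_prod_list P Gs | Gs e. Gs \<noteq> [] \<and> set Gs \<subseteq> Reg P k \<and> e * e = e
                                  \<and> (\<forall>G\<in>set Gs. meval G = e)}"

type_synonym sgraph = "vname set \<times> (vname \<Rightarrow> vname \<Rightarrow> bool)"

definition downcast :: "('m::monoid_mult) mlgraph \<Rightarrow> sgraph" where
  "downcast G = (mverts G, \<lambda>x y. x \<noteq> y \<and> medge G x y 1 1)"

type_synonym lgraph = "vname set \<times> (vname \<Rightarrow> vname \<Rightarrow> bool) \<times> (vname \<Rightarrow> nat)"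

definition lembeds :: "lgraph \<Rightarrow> lgraph \<Rightarrow> bool" where
  "lembeds H H' = (case H of (V, A, c) \<Rightarrow> case H' of (V', A', c') \<Rightarrow>
     (\<exists>h. inj_on h V \<and> h ` V \<subseteq> V' \<and>
          (\<forall>u\<in>V. \<forall>v\<in>V. A' (h u) (h v) \<longleftrightarrow> A u v) \<and>
          (\<forall>v\<in>V. c' (h v) = c v)))"

definition labellings :: "sgraph set \<Rightarrow> nat set \<Rightarrow> lgraph set" where
  "labellings C X = {(V, A, c) | V A c. (V, A) \<in> C \<and> c ` V \<subseteq> X}"

definition good_wqo_on :: "('a \<Rightarrow> 'a \<Rightarrow> bool) \<Rightarrow> 'a set \<Rightarrow> bool" where
  "good_wqo_on le S \<longleftrightarrow> (\<forall>f :: nat \<Rightarrow> 'a. (\<forall>i. f i \<in> S) \<longrightarrow> (\<exists>i j. i < j \<and> le (f i) (f j)))"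

text \<open>Label sets X are taken to be finite sets of natural numbers (every finite
  set is in bijection with one, and wqo is invariant under relabelling).\<close>

definition k_wqo :: "nat \<Rightarrow> sgraph set \<Rightarrow> bool" where
  "k_wqo k C \<longleftrightarrow> (\<forall>X. finite X \<and> card X \<le> k \<longrightarrow> good_wqo_on lembeds (labellings C X))"

definition inf_wqo :: "sgraph set \<Rightarrow> bool" where
  "inf_wqo C \<longleftrightarrow> (\<forall>X. finite X \<longrightarrow> good_wqo_on lembeds (labellings C X))"

end

(* If M is totally ordered, induct on d and strengthen embeddings so that they preserve the
   evaluation, both components of every label and the full edge functions.  Binary products are
   Dickson's lemma.  In an idempotent product over e, every label (l, r) satisfies e l = l or
   r e = r, so adjacency across factors depends on the distance of the factors only between a
   vertex with e l = l and a vertex with e l \<noteq> l of the next factor.  Higman's lemma for the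
   sequence of pairs of consecutive factors therefore suffices.

   If J(ab) is neither J(a) nor J(b), there are x, y outside the ideal J(ab) with xy and yx inside
   it.  Along the word xyxy... the selector "middle component in {x, y}" joins exactly the
   neighbouring gaps, so idempotent products of a fixed block give ever longer paths (with some
   vertices doubled), and marking the two ends yields an antichain. *)
theory Submission
  imports Defs "HOL-Library.Sublist" "HOL-Library.Infinite_Set"
begin

section \<open>Well-quasi-orders\<close>

text \<open>Labels and full edge functions must be preserved exactly, because a later product tests
  \<open>P\<close> on the labels and evaluates the old edge functions at shifted arguments.

  The obstacle in the forward direction is that an embedding of sequences skips factors, while
  adjacency to the next factor can differ from adjacency to a later one. No single map from factors
  to factors will do, so each factor is split. Its vertices with \<open>e l = l\<close> look ahead
  and follow the pair (i, i+1); the others look back and follow the pair (i-1, i). The two halves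
  may land in different factors. This does no harm: if u has \<open>e l \<noteq> l\<close> and v in
  the same factor has \<open>e l = l\<close>, then u comes first, and the total order forces the
  word between them to act as \<open>r_u l_v\<close>, just as if they stood in different factors.

  In the converse one fixed block is built by binary products, at a depth depending only on the
  monoid. A single idempotent product on top repeats it, so one \<open>d\<close> serves paths of all
  lengths.\<close>

lemma good_wqo_onD:
  assumes "good_wqo_on le S" "\<And>i. f i \<in> S"
  obtains i j :: nat where "i < j" "le (f i) (f j)"
  using assms unfolding good_wqo_on_def by blast

text \<open>The coding is a relation and not a function because a product graph comes with no
  distinguished choice of factors; any code of each element may be compared.\<close>

lemma good_wqo_on_reduce:
  assumes good: "good_wqo_on le1 S1"
    and code: "\<And>s. s \<in> S \<Longrightarrow> \<exists>t\<in>S1. R t s"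
    and mono: "\<And>t t' s s'. \<lbrakk>R t s; R t' s'; le1 t t'\<rbrakk> \<Longrightarrow> le s s'"
  shows "good_wqo_on le S"
  unfolding good_wqo_on_def
proof (intro allI impI)
  fix f :: "nat \<Rightarrow> 'b" assume "\<forall>i. f i \<in> S"
  then have "\<forall>i. \<exists>t. t \<in> S1 \<and> R t (f i)"
    using code by blast
  then obtain g where g: "\<And>i. g i \<in> S1" "\<And>i. R (g i) (f i)"
    by metis
  obtain i j :: nat where "i < j" "le1 (g i) (g j)"
    using good_wqo_onD[OF good g(1)] .
  then show "\<exists>i j. i < j \<and> le (f i) (f j)"
    using mono g(2) by blast
qed

lemma good_wqo_on_Un:
  assumes A: "good_wqo_on le A" and B: "good_wqo_on le B"
  shows "good_wqo_on le (A \<union> B)"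
  unfolding good_wqo_on_def
proof (intro allI impI)
  fix f :: "nat \<Rightarrow> 'a" assume f: "\<forall>i. f i \<in> A \<union> B"
  have *: "\<exists>i j. i < j \<and> le (f i) (f j)" if "infinite {i. f i \<in> C}" and C: "good_wqo_on le C" for C
  proof -
    have "f (enumerate {i. f i \<in> C} i) \<in> C" for i
      using enumerate_in_set[OF that(1)] by auto
    then obtain i j where "i < j" "le (f (enumerate {i. f i \<in> C} i)) (f (enumerate {i. f i \<in> C} j))"
      using good_wqo_onD[OF C, of "\<lambda>i. f (enumerate {i. f i \<in> C} i)"] by blast
    then show ?thesis
      using enumerate_mono[OF _ that(1)] by blast
  qed
  have "infinite ({i. f i \<in> A} \<union> {i. f i \<in> B})"
  proof -
    have "{i. f i \<in> A} \<union> {i. f i \<in> B} = UNIV" using f by auto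
    then show ?thesis by simp
  qed
  then show "\<exists>i j. i < j \<and> le (f i) (f j)"
    using * A B by auto
qed

lemma good_wqo_on_finite_key:
  fixes S :: "'a set"
  assumes "finite K" and key: "\<And>s. s \<in> S \<Longrightarrow> key s \<in> K"
    and le: "\<And>s s'. \<lbrakk>s \<in> S; s' \<in> S; key s = key s'\<rbrakk> \<Longrightarrow> le s s'"
  shows "good_wqo_on le S"
  unfolding good_wqo_on_def
proof (intro allI impI)
  fix f :: "nat \<Rightarrow> 'a" assume f: "\<forall>i. f i \<in> S"
  have "\<not> inj (key \<circ> f)"
  proof
    assume "inj (key \<circ> f)"
    moreover have "range (key \<circ> f) \<subseteq> K" using f key by auto
    ultimately show False
      using \<open>finite K\<close> finite_imageD finite_subset infinite_UNIV_nat by blast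
  qed
  then obtain i j where "i \<noteq> j" "key (f i) = key (f j)"
    unfolding inj_def by auto
  then show "\<exists>i j. i < j \<and> le (f i) (f j)"
    using f le by (metis linorder_neqE_nat)
qed

text \<open>The set \<open>T\<close> of indices whose term lies below no later term is finite, since
  enumerating an infinite \<open>T\<close> would give a bad sequence. Beyond \<open>T\<close> every
  term has a later one above it, and transitivity links the chosen steps.\<close>

lemma good_wqo_on_monotone_subseq:
  fixes f :: "nat \<Rightarrow> 'a"
  assumes good: "good_wqo_on le S" and "transp le" and f: "\<And>i. f i \<in> S"
  shows "\<exists>\<phi> :: nat \<Rightarrow> nat. strict_mono \<phi> \<and> (\<forall>i j. i < j \<longrightarrow> le (f (\<phi> i)) (f (\<phi> j)))"
proof -
  define T where "T = {i. \<forall>j>i. \<not> le (f i) (f j)}"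
  have "finite T"
  proof (rule ccontr)
    assume inf: "infinite T"
    obtain i j where ij: "i < j" "le (f (enumerate T i)) (f (enumerate T j))"
      using good_wqo_onD[OF good, of "\<lambda>i. f (enumerate T i)"] f by blast
    then show False
      using enumerate_in_set[OF inf, of i] enumerate_mono[OF ij(1) inf] by (auto simp: T_def)
  qed
  then obtain n where n: "\<And>i. i \<in> T \<Longrightarrow> i < n"
    using finite_nat_set_iff_bounded by auto
  have step: "\<exists>j. j \<ge> n \<and> i < j \<and> le (f i) (f j)" if "i \<ge> n" for i
  proof -
    have "i \<notin> T" using n that by (meson not_le)
    then obtain j where "i < j" "le (f i) (f j)" unfolding T_def by blast
    with that show ?thesis by (intro exI[of _ j]) simp
  qed
  have "\<exists>\<phi>. \<forall>i. n \<le> \<phi> i \<and> (\<phi> i < \<phi> (Suc i) \<and> le (f (\<phi> i)) (f (\<phi> (Suc i))))"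
    by (rule dependent_nat_choice) (use step in auto)
  then obtain \<phi> where \<phi>: "\<And>i. \<phi> i < \<phi> (Suc i)" "\<And>i. le (f (\<phi> i)) (f (\<phi> (Suc i)))"
    by blast
  have "strict_mono \<phi>" using \<phi>(1) by (simp add: strict_mono_Suc_iff)
  moreover have "le (f (\<phi> i)) (f (\<phi> j))" if "i < j" for i j
    using that
  proof (induction rule: less_Suc_induct)
    case (2 i j k)
    then show ?case using \<open>transp le\<close> by (blast dest: transpD)
  qed (use \<phi> in auto)
  ultimately show ?thesis by blast
qed

lemma good_wqo_on_Times:
  assumes A: "good_wqo_on le A" "transp le" and B: "good_wqo_on le' B"
  shows "good_wqo_on (rel_prod le le') (A \<times> B)"
  unfolding good_wqo_on_def
proof (intro allI impI)
  fix f :: "nat \<Rightarrow> 'a \<times> 'b" assume f: "\<forall>i. f i \<in> A \<times> B"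
  then have fA: "\<And>i. fst (f i) \<in> A" and fB: "\<And>i. snd (f i) \<in> B"
    by (simp_all add: mem_Times_iff)
  obtain \<phi> :: "nat \<Rightarrow> nat" where "strict_mono \<phi> \<and> (\<forall>i j. i < j \<longrightarrow> le (fst (f (\<phi> i))) (fst (f (\<phi> j))))"
    using good_wqo_on_monotone_subseq[of le A "\<lambda>i. fst (f i)", OF A fA] by blast
  then have \<phi>: "strict_mono \<phi>" "\<And>i j. i < j \<Longrightarrow> le (fst (f (\<phi> i))) (fst (f (\<phi> j)))"
    by simp_all
  obtain i j where "i < j" "le' (snd (f (\<phi> i))) (snd (f (\<phi> j)))"
    using good_wqo_onD[OF B, of "\<lambda>i. snd (f (\<phi> i))"] fB by blast
  then show "\<exists>i j. i < j \<and> rel_prod le le' (f i) (f j)"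
    using \<phi> by (metis rel_prod_sel strict_monoD)
qed

lemma transp_rel_prod: "transp le \<Longrightarrow> transp le' \<Longrightarrow> transp (rel_prod le le')"
  by (auto simp: transp_def)

text \<open>Nash-Williams: a bad sequence that is lexicographically minimal in the lengths of its
  members stays bad when its members are replaced by their tails along a subsequence with
  increasing heads.\<close>
theorem good_wqo_on_lists:
  assumes good: "good_wqo_on le S" and trans: "transp le"
  shows "good_wqo_on (list_emb le) (lists S)"
proof (rule ccontr)
  define bad where "bad = (\<lambda>f :: nat \<Rightarrow> 'a list.
    (\<forall>i. f i \<in> lists S) \<and> (\<forall>i j. i < j \<longrightarrow> \<not> list_emb le (f i) (f j)))"
  define minat where "minat = (\<lambda>n f. bad f \<and>
    (\<forall>g. bad g \<longrightarrow> (\<forall>i<n. g i = f i) \<longrightarrow> length (f n) \<le> length (g n)))"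
  assume "\<not> good_wqo_on (list_emb le) (lists S)"
  then obtain f0 where f0: "bad f0"
    unfolding good_wqo_on_def bad_def by blast
  have minex: "\<exists>g. minat n g \<and> (\<forall>i<n. g i = f i)" if "bad f" for f n
  proof -
    let ?Q = "\<lambda>g. bad g \<and> (\<forall>i<n. g i = f i)"
    define a where "a = arg_min (\<lambda>g. length (g n)) ?Q"
    have a: "?Q a \<and> (\<forall>g. ?Q g \<longrightarrow> length (a n) \<le> length (g n))"
      unfolding a_def by (rule arg_min_nat_lemma[of ?Q f]) (use that in simp)
    then have "minat n a" unfolding minat_def by simp
    with a show ?thesis by blast
  qed
  \<comment> \<open>Passing from \<open>F n\<close> to \<open>F (Suc n)\<close> keeps the entries up
    to \<open>n\<close>, so the diagonal \<open>m\<close> inherits badness and is minimal at every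
    index.\<close>
  have "\<exists>F. \<forall>n. minat n (F n) \<and> (\<forall>i<Suc n. F (Suc n) i = F n i)"
  proof (rule dependent_nat_choice)
    show "\<exists>g. minat 0 g" using minex[OF f0] by blast
    show "\<exists>g. minat (Suc n) g \<and> (\<forall>i<Suc n. g i = f i)" if "minat n f" for f n
      using minex[of f "Suc n"] that unfolding minat_def by blast
  qed
  then obtain F where F: "\<And>n. minat n (F n)" "\<And>n i. i \<le> n \<Longrightarrow> F (Suc n) i = F n i"
    by (auto simp: less_Suc_eq_le)
  define m where "m = (\<lambda>n. F n n)"
  have agree: "F n i = m i" if "i \<le> n" for n i
    using that by (induction n) (auto simp: m_def F(2) le_Suc_eq)
  have badF: "bad (F n)" for n
    using F(1) unfolding minat_def by blast
  have mS: "m i \<in> lists S" for i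
    using badF[of i] by (simp add: bad_def m_def)
  have mbad: "\<not> list_emb le (m i) (m j)" if "i < j" for i j
  proof -
    have "\<not> list_emb le (F j i) (F j j)"
      using badF[of j] that unfolding bad_def by blast
    then show ?thesis using that by (simp add: agree)
  qed
  have mmin: "length (m n) \<le> length (g n)" if "bad g" "\<And>i. i < n \<Longrightarrow> g i = m i" for g n
  proof -
    have "\<forall>i<n. g i = F n i" using that(2) by (simp add: agree)
    then have "length (F n n) \<le> length (g n)"
      using F(1)[of n] that(1) unfolding minat_def by blast
    then show ?thesis by (simp add: m_def)
  qed
  have mne: "m i \<noteq> []" for i
    using mbad[of i "Suc i"] by auto
  then have msplit: "m i = hd (m i) # tl (m i)" for i
    by simp
  have mhd: "hd (m i) \<in> S" and mtl: "tl (m i) \<in> lists S" for i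
    using mS[of i] mne[of i] by (cases "m i"; simp)+
  obtain \<phi> :: "nat \<Rightarrow> nat" where "strict_mono \<phi> \<and> (\<forall>i j. i < j \<longrightarrow> le (hd (m (\<phi> i))) (hd (m (\<phi> j))))"
    using good_wqo_on_monotone_subseq[of le S "\<lambda>i. hd (m i)", OF good trans mhd] by blast
  then have \<phi>: "strict_mono \<phi>" "\<And>i j. i < j \<Longrightarrow> le (hd (m (\<phi> i))) (hd (m (\<phi> j)))"
    by simp_all
  \<comment> \<open>At index \<open>\<phi> 0\<close> this sequence holds the tail of
    \<open>m (\<phi> 0)\<close>, which is shorter than minimality allows in a bad sequence. A good
    pair of \<open>h\<close> lifts to one of \<open>m\<close> by putting the heads back.\<close>
  define h where "h = (\<lambda>i. if i < \<phi> 0 then m i else tl (m (\<phi> (i - \<phi> 0))))"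
  have "\<not> bad h"
  proof
    assume "bad h"
    then have "length (m (\<phi> 0)) \<le> length (h (\<phi> 0))"
      by (rule mmin) (simp add: h_def)
    then show False using mne[of "\<phi> 0"] by (cases "m (\<phi> 0)") (simp_all add: h_def)
  qed
  moreover have "h i \<in> lists S" for i
    using mS mtl by (simp add: h_def)
  ultimately obtain i j where ij: "i < j" "list_emb le (h i) (h j)"
    unfolding bad_def by blast
  consider "j < \<phi> 0" | "i < \<phi> 0" "\<phi> 0 \<le> j" | "\<phi> 0 \<le> i"
    by linarith
  then show False
  proof cases
    case 1
    then show ?thesis using ij mbad[of i j] by (simp add: h_def)
  next
    case 2
    have "list_emb le (m i) (m (\<phi> (j - \<phi> 0)))"
      using 2 ij(2) by (subst msplit[of "\<phi> (j - \<phi> 0)"]) (auto simp: h_def)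
    moreover have "i < \<phi> (j - \<phi> 0)"
      using 2 \<phi>(1) by (meson le0 less_le_trans strict_mono_less_eq)
    ultimately show ?thesis using mbad by blast
  next
    case 3
    then have lt: "i - \<phi> 0 < j - \<phi> 0" using ij(1) by linarith
    have "list_emb le (m (\<phi> (i - \<phi> 0))) (m (\<phi> (j - \<phi> 0)))"
      using 3 ij \<phi>(2)[OF lt]
      by (subst msplit[of "\<phi> (j - \<phi> 0)"], subst msplit[of "\<phi> (i - \<phi> 0)"]) (auto simp: h_def)
    then show ?thesis using mbad \<phi>(1) lt by (meson strict_monoD)
  qed
qed

lemma list_emb_index_map:
  assumes "list_emb le xs ys"
  obtains f :: "nat \<Rightarrow> nat" where "strict_mono_on {..<length xs} f"
    "\<And>i. i < length xs \<Longrightarrow> f i < length ys \<and> le (xs ! i) (ys ! f i)"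
proof -
  have "\<exists>f. strict_mono_on {..<length xs} f \<and>
      (\<forall>i<length xs. f i < length ys \<and> le (xs ! i) (ys ! f i))"
    using assms
  proof induction
    case (list_emb_Nil ys)
    then show ?case by (simp add: strict_mono_on_def)
  next
    case (list_emb_Cons xs ys y)
    then obtain f where "strict_mono_on {..<length xs} f"
      "\<forall>i<length xs. f i < length ys \<and> le (xs ! i) (ys ! f i)" by blast
    then show ?case by (intro exI[of _ "Suc \<circ> f"]) (simp add: strict_mono_on_def)
  next
    case (list_emb_Cons2 x y xs ys)
    then obtain f where "strict_mono_on {..<length xs} f"
      "\<forall>i<length xs. f i < length ys \<and> le (xs ! i) (ys ! f i)" by blast
    then show ?case using list_emb_Cons2.hyps
      by (intro exI[of _ "case_nat 0 (Suc \<circ> f)"])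
        (auto simp: strict_mono_on_def less_Suc_eq_0_disj split: nat.split)
  qed
  then show ?thesis using that by blast
qed

section \<open>Finite monoids\<close>

lemma ex_idempotent_power:
  fixes u :: "'m::{monoid_mult, finite}"
  obtains n :: nat where "n > 0" "u ^ n * u ^ n = u ^ n"
proof -
  have "\<not> inj (\<lambda>n::nat. u ^ n)"
    by (metis finite_imageD finite infinite_UNIV_nat)
  then obtain i j where ij: "i < j" "u ^ i = u ^ j"
    unfolding inj_def by (metis linorder_neqE_nat)
  define p where "p = j - i"
  have per: "u ^ (n + p * k) = u ^ n" if "i \<le> n" for n k
  proof (induction k)
    case (Suc k)
    have "u ^ (n + p) = u ^ (n - i) * u ^ j"
      using that ij(1) by (simp add: p_def flip: power_add)
    also have "\<dots> = u ^ n"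
      using that ij by (simp flip: ij(2) power_add)
    finally show ?case
      using Suc by (simp add: power_add algebra_simps flip: mult.assoc)
  qed simp
  \<comment> \<open>The exponent \<open>p * Suc i\<close> is a multiple of the period
    \<open>p\<close> and not below the preperiod \<open>i\<close>, so doubling it leaves the power
    unchanged.\<close>
  have "p > 0" using ij by (simp add: p_def)
  then have "i \<le> p * Suc i"
    by (cases p) auto
  then have "u ^ (p * Suc i + p * Suc i) = u ^ (p * Suc i)"
    by (rule per)
  then show ?thesis
    using that[of "p * Suc i"] \<open>p > 0\<close> by (simp flip: power_add)
qed

lemma mem_Jideal_iff: "z \<in> Jideal m \<longleftrightarrow> (\<exists>x y. z = x * m * y)"
  by (auto simp: Jideal_def)

lemma Jideal_self: "m \<in> Jideal m"
  unfolding mem_Jideal_iff by (metis mult_1_left mult_1_right)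

lemma Jideal_mult: "z \<in> Jideal m \<Longrightarrow> x * z * y \<in> Jideal m"
  unfolding mem_Jideal_iff by (metis mult.assoc)

lemma Jideal_mult_left: "z \<in> Jideal m \<Longrightarrow> x * z \<in> Jideal m"
  using Jideal_mult[of z m x 1] by simp

lemma Jideal_mult_right: "z \<in> Jideal m \<Longrightarrow> z * y \<in> Jideal m"
  using Jideal_mult[of z m 1 y] by simp

lemma Jideal_subset: "z \<in> Jideal m \<Longrightarrow> Jideal z \<subseteq> Jideal m"
  using Jideal_mult[of z m] by (auto simp: mem_Jideal_iff[of _ z])

lemma stable_left:
  fixes l r :: "'m::{monoid_mult, finite}"
  assumes "r \<in> Jideal (l * r)"
  obtains z where "r = z * (l * r)"
proof -
  obtain x y where xy: "r = x * (l * r) * y"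
    using assms unfolding mem_Jideal_iff by blast
  have it: "r = (x * l) ^ n * r * y ^ n" for n
  proof (induction n)
    case (Suc n)
    have "r = (x * l) ^ n * (x * (l * r) * y) * y ^ n"
      using Suc xy by simp
    then show ?case by (simp add: mult.assoc power_commutes flip: power_Suc2)
         (metis mult.assoc power_commutes)
  qed simp
  obtain n where n: "n > 0" "(x * l) ^ n * (x * l) ^ n = (x * l) ^ n"
    by (rule ex_idempotent_power)
  have "(x * l) ^ n * r = r"
    using it[of n] n(2) by (metis mult.assoc)
  then have "r = ((x * l) ^ (n - 1) * x) * (l * r)"
    using n(1) by (cases n) (simp_all add: mult.assoc power_commutes flip: power_Suc2, metis mult.assoc power_commutes)
  then show ?thesis using that by blast
qed

lemma stable_right:
  fixes l r :: "'m::{monoid_mult, finite}"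
  assumes "l \<in> Jideal (l * r)"
  obtains z where "l = (l * r) * z"
proof -
  obtain x y where xy: "l = x * (l * r) * y"
    using assms unfolding mem_Jideal_iff by blast
  have it: "l = x ^ n * l * (r * y) ^ n" for n
  proof (induction n)
    case (Suc n)
    have "l = x ^ n * (x * (l * r) * y) * (r * y) ^ n"
      using Suc xy by simp
    then show ?case by (simp add: mult.assoc power_commutes flip: power_Suc2)
         (metis mult.assoc power_commutes)
  qed simp
  obtain n where n: "n > 0" "(r * y) ^ n * (r * y) ^ n = (r * y) ^ n"
    by (rule ex_idempotent_power)
  have "l * (r * y) ^ n = l"
    using it[of n] n(2) by (metis mult.assoc)
  then have "l = (l * r) * (y * (r * y) ^ (n - 1))"
    using n(1) by (cases n) (simp_all add: mult.assoc)
  then show ?thesis using that by blast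
qed

text \<open>Stability turns an equality of two-sided ideals into one-sided divisibility. The forward
  direction uses the total order only through this dichotomy.\<close>

lemma totally_ordered_cases:
  fixes l r :: "'m::{monoid_mult, finite}"
  assumes "monoid_totally_ordered TYPE('m)"
  obtains z where "l = (l * r) * z" | z where "r = z * (l * r)"
  using assms stable_left[of r l] stable_right[of l r] Jideal_self
  unfolding monoid_totally_ordered_def by metis

lemma absorb_left_or_right:
  fixes l r :: "'m::{monoid_mult, finite}"
  assumes "monoid_totally_ordered TYPE('m)" and e: "l * r = e" "e * e = e"
    and "e * l \<noteq> l"
  shows "r * e = r"
  using totally_ordered_cases[OF assms(1), of l r] assms(2-) by (metis mult.assoc)

text \<open>This is what allows a factor to be split. In the dichotomy for \<open>lu * m\<close>,
  the case \<open>lu = lv * z\<close> would give \<open>e * lu = lu\<close>. Hence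
  \<open>m = z * lv\<close>, so \<open>ru = z * e\<close>, and \<open>e\<close> is absorbed by
  \<open>lv\<close>.\<close>

lemma middle_eq:
  fixes lu :: "'m::{monoid_mult, finite}"
  assumes "monoid_totally_ordered TYPE('m)" and e: "lv * rv = e" "e * e = e"
    and "e * lu \<noteq> lu" "e * lv = lv" "lv = lu * m" "ru = m * rv"
  shows "m = ru * lv"
proof -
  from totally_ordered_cases[OF assms(1), of lu m]
  obtain z where z: "m = z * (lu * m)"
    using assms(4-6) by (metis mult.assoc)
  then have mz: "m = z * lv" using assms by simp
  then have "ru = z * e" using assms(2,7) by (simp add: mult.assoc)
  then have "ru * lv = z * lv" using assms(5) by (simp add: mult.assoc)
  with mz show ?thesis by simp
qed

section \<open>Products of monoid-labelled graphs\<close>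

lemma meval_prod [simp]: "meval (mlg_prod P G H) = meval G * meval H"
  and mverts_prod: "mverts (mlg_prod P G H) = Cons False ` mverts G \<union> Cons True ` mverts H"
  and mlab_prod [simp]:
    "mlab (mlg_prod P G H) (False # x) = (fst (mlab G x), snd (mlab G x) * meval H)"
    "mlab (mlg_prod P G H) (True # y) = (meval G * fst (mlab H y), snd (mlab H y))"
  and medge_prod [simp]:
    "medge (mlg_prod P G H) (False # x) (False # x') s t = medge G x x' s (meval H * t)"
    "medge (mlg_prod P G H) (True # y) (True # y') s t = medge H y y' (s * meval G) t"
    "medge (mlg_prod P G H) (False # x) (True # y) s t \<longleftrightarrow>
      (s * fst (mlab G x), snd (mlab G x) * fst (mlab H y), snd (mlab H y) * t) \<in> P"
    "medge (mlg_prod P G H) (True # y) (False # x) s t \<longleftrightarrow>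
      (s * fst (mlab G x), snd (mlab G x) * fst (mlab H y), snd (mlab H y) * t) \<in> P"
  by (simp_all add: mlg_prod_def)

text \<open>The edges between \<open>u\<close> and \<open>v\<close> as if \<open>u\<close> stood to the left of \<open>v\<close> in a word, with the
  factor \<open>m\<close> between them.\<close>
definition linked :: "('m::monoid_mult \<times> 'm \<times> 'm) set \<Rightarrow> 'm mlgraph \<Rightarrow> vname \<Rightarrow> 'm \<Rightarrow> vname \<Rightarrow> bool" where
  "linked P G u m v \<longleftrightarrow> (\<forall>s t.
     (medge G u v s t \<longleftrightarrow> (s * fst (mlab G u), m, snd (mlab G v) * t) \<in> P) \<and>
     (medge G v u s t \<longleftrightarrow> (s * fst (mlab G u), m, snd (mlab G v) * t) \<in> P))"

text \<open>The witness \<open>m\<close> is the product of the word read from \<open>u\<close> to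
  \<open>v\<close>. It is recorded separately because the labels of \<open>u\<close> and
  \<open>v\<close> need not determine it.\<close>

definition precedes :: "('m::monoid_mult \<times> 'm \<times> 'm) set \<Rightarrow> 'm mlgraph \<Rightarrow> vname \<Rightarrow> vname \<Rightarrow> bool" where
  "precedes P G u v \<longleftrightarrow> (\<exists>m. fst (mlab G v) = fst (mlab G u) * m \<and>
     snd (mlab G u) = m * snd (mlab G v) \<and> linked P G u m v)"

definition linear :: "('m::monoid_mult \<times> 'm \<times> 'm) set \<Rightarrow> 'm mlgraph \<Rightarrow> bool" where
  "linear P G \<longleftrightarrow> (\<forall>x\<in>mverts G. fst (mlab G x) * snd (mlab G x) = meval G) \<and>
     (\<forall>u\<in>mverts G. \<forall>v\<in>mverts G. u \<noteq> v \<longrightarrow> precedes P G u v \<or> precedes P G v u)"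

lemma linear_prod:
  assumes G: "linear P G" and H: "linear P H"
  shows "linear P (mlg_prod P G H)"
proof -
  have labG: "fst (mlab G x) * (snd (mlab G x) * z) = meval G * z" if "x \<in> mverts G" for x z
    using G that by (simp add: linear_def flip: mult.assoc)
  have labH: "fst (mlab H x) * snd (mlab H x) = meval H" if "x \<in> mverts H" for x
    using H that by (simp add: linear_def)
  have "precedes P (mlg_prod P G H) (False # x) (False # y)" if "precedes P G x y" for x y
    using that unfolding precedes_def linked_def by (auto simp: mult.assoc)
  then have GG: "precedes P (mlg_prod P G H) (False # x) (False # y) \<or>
      precedes P (mlg_prod P G H) (False # y) (False # x)"
    if "x \<in> mverts G" "y \<in> mverts G" "x \<noteq> y" for x y
    using G that unfolding linear_def by blast
  have "precedes P (mlg_prod P G H) (True # x) (True # y)" if "precedes P H x y" for x y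
    using that unfolding precedes_def linked_def by (auto simp: mult.assoc)
  then have HH: "precedes P (mlg_prod P G H) (True # x) (True # y) \<or>
      precedes P (mlg_prod P G H) (True # y) (True # x)"
    if "x \<in> mverts H" "y \<in> mverts H" "x \<noteq> y" for x y
    using H that unfolding linear_def by blast
  have GH: "precedes P (mlg_prod P G H) (False # x) (True # y)"
    if "x \<in> mverts G" "y \<in> mverts H" for x y
    unfolding precedes_def linked_def
    by (rule exI[of _ "snd (mlab G x) * fst (mlab H y)"]) (simp add: that labG labH mult.assoc)
  show ?thesis
    unfolding linear_def[of P "mlg_prod P G H"]
    by (auto simp: mverts_prod labG labH mult.assoc intro: GH dest: GG HH)
qed

lemma linear_foldl:
  "linear P G \<Longrightarrow> (\<And>H. H \<in> set Gs \<Longrightarrow> linear P H) \<Longrightarrow> linear P (foldl (mlg_prod P) G Gs)"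
  by (induction Gs arbitrary: G) (simp_all add: linear_prod)

lemma linear_Reg: "G \<in> Reg P d \<Longrightarrow> linear P G"
proof (induction d arbitrary: G)
  case 0
  then show ?case by (auto simp: linear_def mlg_wf_def card_Suc_eq)
next
  case (Suc d)
  then consider G1 G2 where "G = mlg_prod P G1 G2" "G1 \<in> Reg P d" "G2 \<in> Reg P d"
    | Gs where "G = mlg_prod_list P Gs" "Gs \<noteq> []" "set Gs \<subseteq> Reg P d"
    by auto
  then show ?case
  proof cases
    case 1
    then show ?thesis using Suc.IH linear_prod by blast
  next
    case (2 Gs)
    then show ?thesis using Suc.IH by (cases Gs) (auto intro!: linear_foldl)
  qed
qed

lemma mlg_prod_list_snoc:
  "Gs \<noteq> [] \<Longrightarrow> mlg_prod_list P (Gs @ [G]) = mlg_prod P (mlg_prod_list P Gs) G"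
  by (cases Gs) simp_all

lemma mult_idem: "e * e = e \<Longrightarrow> e * (e * x) = (e * x :: 'm::monoid_mult)"
  by (simp flip: mult.assoc)

text \<open>\<open>\<iota> i x\<close> is the name that vertex \<open>x\<close> of the \<open>i\<close>-th factor receives in an idempotent
  product \<open>H\<close>.\<close>
locale idempotent_product =
  fixes P :: "('m::monoid_mult \<times> 'm \<times> 'm) set" and e :: 'm and Gs :: "'m mlgraph list"
    and \<iota> :: "nat \<Rightarrow> vname \<Rightarrow> vname" and H :: "'m mlgraph"
  assumes idem: "e * e = e"
    and factors: "\<And>i. i < length Gs \<Longrightarrow> linear P (Gs ! i) \<and> meval (Gs ! i) = e"
    and meval: "meval H = e"
    and mverts: "mverts H = (\<Union>i<length Gs. \<iota> i ` mverts (Gs ! i))"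
    and inj: "\<And>i j x y. \<lbrakk>i < length Gs; j < length Gs; x \<in> mverts (Gs ! i); y \<in> mverts (Gs ! j);
          \<iota> i x = \<iota> j y\<rbrakk> \<Longrightarrow> i = j \<and> x = y"
    and lab: "\<And>i x. \<lbrakk>i < length Gs; x \<in> mverts (Gs ! i)\<rbrakk> \<Longrightarrow> mlab H (\<iota> i x) =
          (if i = 0 then fst (mlab (Gs ! i) x) else e * fst (mlab (Gs ! i) x),
           if Suc i = length Gs then snd (mlab (Gs ! i) x) else snd (mlab (Gs ! i) x) * e)"
    and edge_within: "\<And>i x y s t. \<lbrakk>i < length Gs; x \<in> mverts (Gs ! i); y \<in> mverts (Gs ! i)\<rbrakk> \<Longrightarrow>
          medge H (\<iota> i x) (\<iota> i y) s t =
          medge (Gs ! i) x y (if i = 0 then s else s * e) (if Suc i = length Gs then t else e * t)"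
    and linked_across: "\<And>i j x y. \<lbrakk>i < j; j < length Gs; x \<in> mverts (Gs ! i); y \<in> mverts (Gs ! j)\<rbrakk> \<Longrightarrow>
          linked P H (\<iota> i x)
            (snd (mlab (Gs ! i) x) * (if j = Suc i then fst (mlab (Gs ! j) y) else e * fst (mlab (Gs ! j) y)))
            (\<iota> j y)"

lemma idempotent_product_single:
  assumes "e * e = e" "linear P G" "meval G = e"
  shows "idempotent_product P e [G] (\<lambda>_ x. x) G"
  using assms by unfold_locales auto

text \<open>The former last factor gains a trailing \<open>e\<close> on its right labels. Earlier
  factors already carry one, and a second \<open>e\<close> is absorbed by idempotence.\<close>

lemma idempotent_product_snoc:
  assumes "idempotent_product P e Gs \<iota> H" and "Gs \<noteq> []" and G: "linear P G" "meval G = e"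
  shows "idempotent_product P e (Gs @ [G])
    (\<lambda>i x. if i < length Gs then False # \<iota> i x else True # x) (mlg_prod P H G)"
proof -
  interpret H: idempotent_product P e Gs \<iota> H by fact
  note ee = mult_idem[OF H.idem]
  have mem: "\<iota> i x \<in> mverts H" if "i < length Gs" "x \<in> mverts (Gs ! i)" for i x
    using that H.mverts by auto
  show ?thesis
  proof unfold_locales
    fix i j x y
    assume *: "i < j" "j < length (Gs @ [G])" "x \<in> mverts ((Gs @ [G]) ! i)" "y \<in> mverts ((Gs @ [G]) ! j)"
    show "linked P (mlg_prod P H G) (if i < length Gs then False # \<iota> i x else True # x)
          (snd (mlab ((Gs @ [G]) ! i) x) *
             (if j = Suc i then fst (mlab ((Gs @ [G]) ! j) y) else e * fst (mlab ((Gs @ [G]) ! j) y)))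
          (if j < length Gs then False # \<iota> j y else True # y)"
    proof (cases "j < length Gs")
      case True
      then show ?thesis
        using * H.linked_across[of i j x y] G
        by (simp add: nth_append linked_def H.meval mult.assoc)
    next
      case False
      then have "j = length Gs" "i < length Gs" using * by auto
      then show ?thesis
        using * by (auto simp: nth_append linked_def H.meval H.lab mult.assoc)
    qed
  qed (use H.idem H.factors H.meval H.inj G assms(2) ee mem in
      \<open>auto simp: nth_append mverts_prod H.mverts H.lab H.edge_within less_Suc_eq mult.assoc
        split: if_splits\<close>)
qed

lemma ex_idempotent_product:
  assumes "Gs \<noteq> []" "e * e = e" "\<And>G. G \<in> set Gs \<Longrightarrow> linear P G \<and> meval G = e"
  shows "\<exists>\<iota>. idempotent_product P e Gs \<iota> (mlg_prod_list P Gs)"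
  using assms
proof (induction Gs rule: rev_nonempty_induct)
  case (single G)
  then show ?case using idempotent_product_single[of e P G] by auto
next
  case (snoc G Gs)
  then obtain \<iota> where "idempotent_product P e Gs \<iota> (mlg_prod_list P Gs)" by auto
  then show ?case
    using idempotent_product_snoc[of P e Gs \<iota> _ G] snoc.prems snoc.hyps
    by (auto simp: mlg_prod_list_snoc)
qed

section \<open>Embeddings of idempotent products\<close>

text \<open>Edges are compared in all contexts \<open>s\<close>, \<open>t\<close>, which keeps the
  notion stable under products. The diagonal is left out, as downcasting ignores it.\<close>

definition is_membedding ::
    "(vname \<Rightarrow> vname) \<Rightarrow> 'm mlgraph \<Rightarrow> (vname \<Rightarrow> nat) \<Rightarrow> 'm mlgraph \<Rightarrow> (vname \<Rightarrow> nat) \<Rightarrow> bool" where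
  "is_membedding h G c G' c' \<longleftrightarrow> inj_on h (mverts G) \<and> h ` mverts G \<subseteq> mverts G' \<and>
     (\<forall>x\<in>mverts G. mlab G' (h x) = mlab G x \<and> c' (h x) = c x) \<and>
     (\<forall>x\<in>mverts G. \<forall>y\<in>mverts G. x \<noteq> y \<longrightarrow>
        (\<forall>s t. medge G' (h x) (h y) s t = medge G x y s t))"

lemma is_membeddingD:
  assumes "is_membedding h G c G' c'" "x \<in> mverts G"
  shows "h x \<in> mverts G'" "mlab G' (h x) = mlab G x" "c' (h x) = c x"
    "y \<in> mverts G \<Longrightarrow> h x = h y \<longleftrightarrow> x = y"
    "y \<in> mverts G \<Longrightarrow> x \<noteq> y \<Longrightarrow> medge G' (h x) (h y) s t = medge G x y s t"
  using assms unfolding is_membedding_def by (auto simp: inj_on_eq_iff)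

fun membeds :: "'m mlgraph \<times> (vname \<Rightarrow> nat) \<Rightarrow> 'm mlgraph \<times> (vname \<Rightarrow> nat) \<Rightarrow> bool" where
  "membeds (G, c) (G', c') \<longleftrightarrow> meval G = meval G' \<and> (\<exists>h. is_membedding h G c G' c')"

lemma is_membedding_comp:
  assumes h: "is_membedding h G c G' c'" and k: "is_membedding k G' c' G'' c''"
  shows "is_membedding (k \<circ> h) G c G'' c''"
  unfolding is_membedding_def
proof (intro conjI ballI allI impI)
  show "inj_on (k \<circ> h) (mverts G)"
    using is_membeddingD[OF h] is_membeddingD[OF k] by (simp add: inj_on_def)
qed (use is_membeddingD[OF h] is_membeddingD[OF k] in auto)

lemma transp_membeds: "transp membeds"
  unfolding transp_def by (auto intro: is_membedding_comp)

lemma linked_medge_eq: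
  assumes "linked P H u m v" "linked P H' u' m v'" "mlab H' u' = mlab H u" "mlab H' v' = mlab H v"
  shows "(\<forall>s t. medge H' u' v' s t = medge H u v s t) \<and> (\<forall>s t. medge H' v' u' s t = medge H v u s t)"
  using assms by (simp add: linked_def)

locale ordered_idempotent_product = idempotent_product P e Gs \<iota> H
  for P :: "('m::{monoid_mult, finite} \<times> 'm \<times> 'm) set" and e Gs \<iota> H +
  assumes ordered: "monoid_totally_ordered TYPE('m)"
begin

abbreviation left_fixed :: "nat \<Rightarrow> vname \<Rightarrow> bool" where
  "left_fixed i x \<equiv> e * fst (mlab (Gs ! i) x) = fst (mlab (Gs ! i) x)"

lemma lab_mult:
  "i < length Gs \<Longrightarrow> x \<in> mverts (Gs ! i) \<Longrightarrow> fst (mlab (Gs ! i) x) * snd (mlab (Gs ! i) x) = e"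
  using factors[of i] by (auto simp: linear_def)

lemma right_fixed:
  assumes "i < length Gs" "x \<in> mverts (Gs ! i)" "\<not> left_fixed i x"
  shows "snd (mlab (Gs ! i) x) * e = snd (mlab (Gs ! i) x)"
  using absorb_left_or_right[OF ordered lab_mult idem] assms by blast

text \<open>These are the pairs whose middle factor is \<open>r l\<close> at every distance, since
  an \<open>e\<close> between the two vertices is absorbed by one of them; they may be moved freely.
  Within one factor, a vertex preceded by a left-fixed one has its left label in \<open>e M\<close>
  and is itself left-fixed, so \<open>x\<close> must come before \<open>y\<close> and
  \<open>middle_eq\<close> applies.\<close>

lemma linked_generic:
  assumes ij: "i < length Gs" "j < length Gs" and x: "x \<in> mverts (Gs ! i)" and y: "y \<in> mverts (Gs ! j)"
    and cases: "i < j \<and> (left_fixed j y \<or> \<not> left_fixed i x) \<or> i = j \<and> left_fixed j y \<and> \<not> left_fixed i x"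
  shows "linked P H (\<iota> i x) (snd (mlab (Gs ! i) x) * fst (mlab (Gs ! j) y)) (\<iota> j y)"
  using cases
proof (elim disjE conjE)
  assume "i < j" "left_fixed j y"
  then show ?thesis using linked_across[of i j x y] ij x y by (cases "j = Suc i") simp_all
next
  assume "i < j" "\<not> left_fixed i x"
  then show ?thesis using linked_across[of i j x y] ij x y right_fixed[of i x]
    by (cases "j = Suc i") (simp_all flip: mult.assoc)
next
  assume eq: "i = j" and yR: "left_fixed j y" and xL: "\<not> left_fixed i x"
  let ?G = "Gs ! i"
  have "x \<noteq> y" using eq yR xL by auto
  moreover have "\<not> precedes P ?G y x"
  proof
    assume "precedes P ?G y x"
    then obtain m where "fst (mlab ?G x) = fst (mlab ?G y) * m"
      unfolding precedes_def by blast
    then show False using xL yR eq by (simp flip: mult.assoc)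
  qed
  ultimately have "precedes P ?G x y"
    using factors[OF ij(1)] x y eq unfolding linear_def by blast
  then obtain m where m: "fst (mlab ?G y) = fst (mlab ?G x) * m" "snd (mlab ?G x) = m * snd (mlab ?G y)"
    and link: "linked P ?G x m y"
    unfolding precedes_def by blast
  have "m = snd (mlab ?G x) * fst (mlab ?G y)"
    using middle_eq[OF ordered _ idem _ _ m] lab_mult[OF ij(2) y] xL yR eq by blast
  then show ?thesis
    using link x y eq ij unfolding linked_def by (simp add: edge_within lab mult.assoc)
qed

lemma linked_within:
  assumes "i < length Gs" "x \<in> mverts (Gs ! i)" "y \<in> mverts (Gs ! i)" "x \<noteq> y"
  obtains m where "linked P (Gs ! i) x m y \<or> linked P (Gs ! i) y m x"
  using factors[OF assms(1)] assms unfolding linear_def precedes_def by blast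

text \<open>Left-fixed vertices absorb an \<open>e\<close> coming from the left, so it does not
  matter whether their factor is the first one. This covers a factor 0 whose left-fixed half is
  moved to the right. The other half can leave the last position, for which the dual lemma
  serves.\<close>

lemma edge_left_fixed:
  assumes i: "i < length Gs" and x: "x \<in> mverts (Gs ! i)" and y: "y \<in> mverts (Gs ! i)" and "x \<noteq> y"
    and "left_fixed i x" "left_fixed i y"
  shows "medge H (\<iota> i x) (\<iota> i y) s t = medge (Gs ! i) x y s (if Suc i = length Gs then t else e * t)"
proof -
  obtain m where m: "linked P (Gs ! i) x m y \<or> linked P (Gs ! i) y m x"
    using linked_within[OF i x y assms(4)] .
  have "medge (Gs ! i) x y (s * e) t' = medge (Gs ! i) x y s t'" for t'
    using m assms(5,6) by (auto simp: linked_def mult.assoc)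
  then show ?thesis using i x y by (simp add: edge_within)
qed

lemma edge_not_left_fixed:
  assumes i: "i < length Gs" and x: "x \<in> mverts (Gs ! i)" and y: "y \<in> mverts (Gs ! i)" and "x \<noteq> y"
    and "\<not> left_fixed i x" "\<not> left_fixed i y"
  shows "medge H (\<iota> i x) (\<iota> i y) s t = medge (Gs ! i) x y (if i = 0 then s else s * e) t"
proof -
  obtain m where m: "linked P (Gs ! i) x m y \<or> linked P (Gs ! i) y m x"
    using linked_within[OF i x y assms(4)] .
  have "medge (Gs ! i) x y s' (e * t) = medge (Gs ! i) x y s' t" for s'
    using m right_fixed[OF i x assms(5)] right_fixed[OF i y assms(6)]
    by (auto simp: linked_def simp flip: mult.assoc)
  then show ?thesis
    by (cases "Suc i = length Gs") (simp_all add: edge_within[OF i x y] split del: if_split)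
qed

end

text \<open>A vertex \<open>x\<close> of the \<open>i\<close>-th factor is sent to factor \<open>F i\<close> or \<open>F (Suc i) - 1\<close>, according
  to whether \<open>e\<close> acts trivially on its left label.  Adjacency across factors depends on their
  distance only between a left-fixed vertex and a later vertex that is not left-fixed, and these
  two land in consecutive factors iff they came from consecutive factors.\<close>
lemma membeds_idempotent_product:
  assumes A: "ordered_idempotent_product P e Gs \<iota> H" and B: "ordered_idempotent_product P e Gs' \<iota>' H'"
    and F: "strict_mono_on {..length Gs} F" "F 0 = 0" "F (length Gs) = length Gs'"
    and hL: "\<And>i. i < length Gs \<Longrightarrow>
      is_membedding (hL i) (Gs ! i) (C \<circ> \<iota> i) (Gs' ! F i) (C' \<circ> \<iota>' (F i))"
    and hR: "\<And>i. i < length Gs \<Longrightarrow>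
      is_membedding (hR i) (Gs ! i) (C \<circ> \<iota> i) (Gs' ! (F (Suc i) - 1)) (C' \<circ> \<iota>' (F (Suc i) - 1))"
  shows "membeds (H, C) (H', C')"
proof -
  interpret A: ordered_idempotent_product P e Gs \<iota> H by fact
  interpret B: ordered_idempotent_product P e Gs' \<iota>' H' by fact
  let ?n = "length Gs" let ?n' = "length Gs'"
  let ?V = "\<lambda>i. mverts (Gs ! i)"
  have Fless: "F i < F j" if "i < j" "j \<le> ?n" for i j
    using strict_mono_onD[OF F(1)] that by simp
  have Fle: "F i \<le> F j" if "i \<le> j" "j \<le> ?n" for i j
    using Fless[of i j] that by (cases "i = j") auto
  define b where "b = (\<lambda>i x. if A.left_fixed i x then F (Suc i) - 1 else F i)"
  define z where "z = (\<lambda>i x. if A.left_fixed i x then hR i x else hL i x)"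
  have Fn: "F i < ?n'" "F (Suc i) - 1 < ?n'" "F i < F (Suc i)" if "i < ?n" for i
    using Fless[of i ?n] Fle[of "Suc i" ?n] Fless[of i "Suc i"] that F(3) by auto
  have b: "b i x < ?n'" if "i < ?n" for i x
    using Fn[OF that] by (simp add: b_def)
  have z: "z i x \<in> mverts (Gs' ! b i x)" "mlab (Gs' ! b i x) (z i x) = mlab (Gs ! i) x"
      "C' (\<iota>' (b i x) (z i x)) = C (\<iota> i x)" if "i < ?n" "x \<in> ?V i" for i x
    using is_membeddingD[OF hL] is_membeddingD[OF hR] that by (auto simp: b_def z_def)
  have lf: "B.left_fixed (b i x) (z i x) \<longleftrightarrow> A.left_fixed i x" if "i < ?n" "x \<in> ?V i" for i x
    using z(2)[OF that] by simp
  define K where "K = Sigma {..<?n} ?V"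
  have injK: "inj_on (\<lambda>(i, x). \<iota> i x) K"
    using A.inj by (auto simp: inj_on_def K_def)
  define \<Phi> where "\<Phi> = (\<lambda>v. case inv_into K (\<lambda>(i, x). \<iota> i x) v of (i, x) \<Rightarrow> \<iota>' (b i x) (z i x))"
  have \<Phi>: "\<Phi> (\<iota> i x) = \<iota>' (b i x) (z i x)" if "i < ?n" "x \<in> ?V i" for i x
    using inv_into_f_f[OF injK, of "(i, x)"] that by (simp add: \<Phi>_def K_def)
  have lab\<Phi>: "mlab H' (\<Phi> (\<iota> i x)) = mlab H (\<iota> i x)" if ix: "i < ?n" "x \<in> ?V i" for i x
  proof -
    \<comment> \<open>Only the first and the last factor lack an \<open>e\<close> in their labels. A
      left-fixed vertex lands in the last factor exactly when it came from there, and is insensitive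
      to \<open>e\<close> on the left. The remaining vertices behave dually at the first
      factor.\<close>
    have "F (Suc i) = ?n' \<longleftrightarrow> Suc i = ?n"
      using Fless[of "Suc i" ?n] ix F(3) by (cases "Suc i = ?n") auto
    moreover have "F i = 0 \<longleftrightarrow> i = 0"
      using Fless[of 0 i] ix F(2) by (cases i) auto
    ultimately show ?thesis
      using ix z[OF ix] Fn[OF ix(1)] A.right_fixed[OF ix]
      by (auto simp: \<Phi> A.lab B.lab b b_def split: if_splits)
  qed
  define same where "same = (\<lambda>u v. \<forall>s t. medge H' (\<Phi> u) (\<Phi> v) s t = medge H u v s t)"
  have transfer: "same (\<iota> i x) (\<iota> j y) \<and> same (\<iota> j y) (\<iota> i x)"
    if "i < ?n" "x \<in> ?V i" "j < ?n" "y \<in> ?V j" "linked P H (\<iota> i x) m (\<iota> j y)"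
      "linked P H' (\<iota>' (b i x) (z i x)) m (\<iota>' (b j y) (z j y))" for i j x y m
    using linked_medge_eq[OF that(5,6)] lab\<Phi>[OF that(1,2)] lab\<Phi>[OF that(3,4)] that(1-4)
    by (simp add: same_def \<Phi>)
  have ordered: "same (\<iota> i x) (\<iota> j y) \<and> same (\<iota> j y) (\<iota> i x)"
    if ij: "i < j" "j < ?n" and x: "x \<in> ?V i" and y: "y \<in> ?V j" for i j x y
  proof -
    have i: "i < ?n" using ij by simp
    note Fs = Fn(3)[OF i] Fn(3)[OF ij(2)] Fle[of "Suc i" j] ij
    show ?thesis
    proof (cases "A.left_fixed j y \<or> \<not> A.left_fixed i x")
      case True
      have "b i x < b j y \<or> b i x = b j y \<and> A.left_fixed j y \<and> \<not> A.left_fixed i x"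
        using Fs True by (auto simp: b_def)
      then have "linked P H' (\<iota>' (b i x) (z i x))
          (snd (mlab (Gs' ! b i x) (z i x)) * fst (mlab (Gs' ! b j y) (z j y))) (\<iota>' (b j y) (z j y))"
        using True lf[OF i x] lf[OF ij(2) y]
        by (intro B.linked_generic b z i ij x y) auto
      moreover have "linked P H (\<iota> i x) (snd (mlab (Gs ! i) x) * fst (mlab (Gs ! j) y)) (\<iota> j y)"
        using True by (intro A.linked_generic i ij x y) (use ij in auto)
      ultimately show ?thesis
        using transfer[OF i x ij(2) y] z(2)[OF i x] z(2)[OF ij(2) y] by simp
    next
      case False
      have less: "b i x < b j y" and Suc: "b j y = Suc (b i x) \<longleftrightarrow> j = Suc i"
        using Fs False Fless[of "Suc i" j] by (cases "j = Suc i"; auto simp: b_def)+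
      show ?thesis
        using transfer[OF i x ij(2) y A.linked_across[OF ij x y]] z(2)[OF i x] z(2)[OF ij(2) y] Suc
          B.linked_across[OF less b[OF ij(2)] z(1)[OF i x] z(1)[OF ij(2) y]]
        by (cases "j = Suc i") simp_all
    qed
  qed
  have within_mixed: "same (\<iota> i x) (\<iota> i y) \<and> same (\<iota> i y) (\<iota> i x)"
    if i: "i < ?n" and x: "x \<in> ?V i" and y: "y \<in> ?V i"
      and xy: "\<not> A.left_fixed i x" "A.left_fixed i y" for i x y
  proof -
    \<comment> \<open>The two halves of a factor may be separated here, but never swapped:
      \<open>F i \<le> F (Suc i) - 1\<close>. The link is generic in the source and in the
      target.\<close>
    have "b i x < b i y \<or> b i x = b i y"
      using Fn(3)[OF i] xy by (auto simp: b_def)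
    then have "linked P H' (\<iota>' (b i x) (z i x))
        (snd (mlab (Gs' ! b i x) (z i x)) * fst (mlab (Gs' ! b i y) (z i y))) (\<iota>' (b i y) (z i y))"
      using xy lf[OF i x] lf[OF i y] by (intro B.linked_generic b z i x y) auto
    moreover have "linked P H (\<iota> i x) (snd (mlab (Gs ! i) x) * fst (mlab (Gs ! i) y)) (\<iota> i y)"
      using xy by (intro A.linked_generic i x y) auto
    ultimately show ?thesis
      using transfer[OF i x i y] z(2)[OF i x] z(2)[OF i y] by simp
  qed
  have within_same: "same (\<iota> i x) (\<iota> i y)"
    if i: "i < ?n" and x: "x \<in> ?V i" and y: "y \<in> ?V i" and "x \<noteq> y"
      and xy: "A.left_fixed i x \<longleftrightarrow> A.left_fixed i y" for i x y
  proof -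
    have beq: "b i x = b i y" using xy by (simp add: b_def)
    have zne: "z i x \<noteq> z i y"
      and edge: "medge (Gs' ! b i x) (z i x) (z i y) s t = medge (Gs ! i) x y s t" for s t
      using is_membeddingD[OF hL[OF i] x] is_membeddingD[OF hR[OF i] x] y \<open>x \<noteq> y\<close> xy
      by (auto simp: b_def z_def)
    have zy: "z i y \<in> mverts (Gs' ! b i x)" using z(1)[OF i y] beq by simp
    have lfy: "B.left_fixed (b i x) (z i y) \<longleftrightarrow> A.left_fixed i y" using lf[OF i y] beq by simp
    show ?thesis
    proof (cases "A.left_fixed i x")
      case True
      have "Suc (b i x) = ?n' \<longleftrightarrow> Suc i = ?n"
        using Fless[of "Suc i" ?n] Fn[OF i] i F(3) True by (cases "Suc i = ?n") (auto simp: b_def)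
      then show ?thesis
        unfolding same_def
        using A.edge_left_fixed[OF i x y] B.edge_left_fixed[OF b[OF i] z(1)[OF i x] zy zne]
          True xy lf[OF i x] lfy \<open>x \<noteq> y\<close> by (simp add: \<Phi> i x y beq[symmetric] edge)
    next
      case False
      have "b i x = 0 \<longleftrightarrow> i = 0"
        using Fless[of 0 i] i F(2) False by (cases i) (auto simp: b_def)
      then show ?thesis
        unfolding same_def
        using A.edge_not_left_fixed[OF i x y] B.edge_not_left_fixed[OF b[OF i] z(1)[OF i x] zy zne]
          False xy lf[OF i x] lfy \<open>x \<noteq> y\<close> by (simp add: \<Phi> i x y beq[symmetric] edge)
    qed
  qed
  have same: "same (\<iota> i x) (\<iota> j y)"
    if "i < ?n" "j < ?n" "x \<in> ?V i" "y \<in> ?V j" "\<iota> i x \<noteq> \<iota> j y" for i j x y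
  proof (cases i j rule: linorder_cases)
    case equal
    then show ?thesis using that within_same within_mixed by blast
  qed (use that ordered in blast)+
  have inj: "i = j \<and> x = y"
    if ix: "i < ?n" "x \<in> ?V i" and jy: "j < ?n" "y \<in> ?V j" and eq: "\<Phi> (\<iota> i x) = \<Phi> (\<iota> j y)" for i j x y
  proof -
    have bz: "b i x = b j y \<and> z i x = z j y"
      using eq B.inj[OF b[OF ix(1)] b[OF jy(1)] z(1)[OF ix] z(1)[OF jy]] by (simp add: \<Phi> ix jy)
    then have type: "A.left_fixed i x \<longleftrightarrow> A.left_fixed j y"
      using lf[OF ix] lf[OF jy] by simp
    \<comment> \<open>On vertices of one type, the target index is \<open>F i\<close> or
      \<open>F (Suc i) - 1\<close>, and each of these is strictly increasing in
      \<open>i\<close>.\<close>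
    have "i = j"
      using bz type Fn(3)[OF ix(1)] Fn(3)[OF jy(1)] Fless[of i j] Fless[of j i]
        Fless[of "Suc i" "Suc j"] Fless[of "Suc j" "Suc i"] ix jy
      by (cases i j rule: linorder_cases) (auto simp: b_def split: if_splits)
    then show ?thesis
      using bz type is_membeddingD(4)[OF hL] is_membeddingD(4)[OF hR] ix jy
      by (auto simp: z_def split: if_splits)
  qed
  have mem: "\<exists>i<?n. \<exists>x\<in>?V i. v = \<iota> i x" if "v \<in> mverts H" for v
    using that by (auto simp: A.mverts)
  have "is_membedding \<Phi> H C H' C'"
    unfolding is_membedding_def
  proof (intro conjI ballI impI allI)
    show "inj_on \<Phi> (mverts H)"
      unfolding inj_on_def using mem inj by metis
    show "\<Phi> ` mverts H \<subseteq> mverts H'"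
      using b z(1) by (fastforce simp: \<Phi> A.mverts B.mverts)
    show "mlab H' (\<Phi> v) = mlab H v" "C' (\<Phi> v) = C v" if "v \<in> mverts H" for v
      using mem[OF that] lab\<Phi> z(3) \<Phi> by auto
    show "medge H' (\<Phi> u) (\<Phi> v) s t = medge H u v s t"
      if "u \<in> mverts H" "v \<in> mverts H" "u \<noteq> v" for u v s t
      using mem[OF that(1)] mem[OF that(2)] same that(3) unfolding same_def by metis
  qed
  then show ?thesis by (auto simp: A.meval B.meval)
qed

section \<open>Induction on the depth for coloured graphs\<close>

definition colored_Reg ::
    "('m::monoid_mult \<times> 'm \<times> 'm) set \<Rightarrow> nat \<Rightarrow> nat set \<Rightarrow> ('m mlgraph \<times> (vname \<Rightarrow> nat)) set" where
  "colored_Reg P d X = {(G, c). G \<in> Reg P d \<and> c ` mverts G \<subseteq> X}"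

lemma good_wqo_on_colored_Reg_0:
  fixes P :: "('m::{monoid_mult, finite} \<times> 'm \<times> 'm) set"
  assumes "finite X"
  shows "good_wqo_on membeds (colored_Reg P 0 X)"
proof (rule good_wqo_on_finite_key)
  define v where "v = (\<lambda>G :: 'm mlgraph. the_elem (mverts G))"
  let ?key = "\<lambda>(G, c). (meval G, mlab G (v G), c (v G))"
  have single: "mverts G = {v G}" if "(G, c) \<in> colored_Reg P 0 X" for G c
    using that by (auto simp: colored_Reg_def v_def card_1_singleton_iff)
  show "finite (UNIV \<times> UNIV \<times> X :: ('m \<times> ('m \<times> 'm) \<times> nat) set)"
    using assms by simp
  show "?key s \<in> UNIV \<times> UNIV \<times> X" if s: "s \<in> colored_Reg P 0 X" for s
  proof -
    obtain G c where G: "s = (G, c)" by fastforce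
    then have "c (v G) \<in> X"
      using s single[of G c] unfolding colored_Reg_def by blast
    then show ?thesis using G by simp
  qed
  show "membeds s s'"
    if s: "s \<in> colored_Reg P 0 X" and s': "s' \<in> colored_Reg P 0 X" and eq: "?key s = ?key s'" for s s'
  proof -
    obtain G c where G: "s = (G, c)" by fastforce
    obtain G' c' where G': "s' = (G', c')" by fastforce
    have "is_membedding (\<lambda>_. v G') G c G' c'"
      using single[of G c] single[of G' c'] s s' eq unfolding is_membedding_def G G' by simp
    then show ?thesis using eq G G' by auto
  qed
qed

lemma is_membedding_prod:
  assumes h1: "is_membedding h1 G1 (c \<circ> Cons False) G1' (c' \<circ> Cons False)"
    and h2: "is_membedding h2 G2 (c \<circ> Cons True) G2' (c' \<circ> Cons True)"
    and eval: "meval G1 = meval G1'" "meval G2 = meval G2'"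
  shows "is_membedding (\<lambda>u. hd u # (if hd u then h2 else h1) (tl u))
    (mlg_prod P G1 G2) c (mlg_prod P G1' G2') c'"
  unfolding is_membedding_def inj_on_def
  using is_membeddingD[OF h1] is_membeddingD[OF h2] eval by (auto simp: mverts_prod)

lemma membeds_prod:
  assumes "membeds (G1, c \<circ> Cons False) (G1', c' \<circ> Cons False)"
    and "membeds (G2, c \<circ> Cons True) (G2', c' \<circ> Cons True)"
  shows "membeds (mlg_prod P G1 G2, c) (mlg_prod P G1' G2', c')"
  using assms is_membedding_prod by fastforce

text \<open>If pair \<open>k\<close> is sent to pair \<open>f k\<close>, then \<open>A k\<close>
  lies below entry \<open>f k\<close> and \<open>A (Suc k)\<close> below entry
  \<open>Suc (f k)\<close>. Setting \<open>F (Suc k) = Suc (f k)\<close> makes these the end of one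
  block and the start of the next. The outer ends belong to no such cut, which is why the first and
  last entries are compared separately.\<close>

lemma list_emb_consecutive_pairs:
  fixes A :: "nat \<Rightarrow> 'a" and B :: "nat \<Rightarrow> 'a"
  assumes first: "le (A 0) (B 0)" and last: "le (A m) (B n)"
    and emb: "list_emb (rel_prod le le)
      (map (\<lambda>i. (A i, A (Suc i))) [0..<m]) (map (\<lambda>i. (B i, B (Suc i))) [0..<n])"
  obtains F where "strict_mono_on {..Suc m} F" "F 0 = 0" "F (Suc m) = Suc n"
    "\<And>i. i \<le> m \<Longrightarrow> le (A i) (B (F i))" "\<And>i. i \<le> m \<Longrightarrow> le (A i) (B (F (Suc i) - 1))"
proof -
  obtain f where f: "strict_mono_on {..<length (map (\<lambda>i. (A i, A (Suc i))) [0..<m])} f"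
    and fle: "\<And>i. i < length (map (\<lambda>i. (A i, A (Suc i))) [0..<m]) \<Longrightarrow>
      f i < length (map (\<lambda>i. (B i, B (Suc i))) [0..<n]) \<and>
      rel_prod le le (map (\<lambda>i. (A i, A (Suc i))) [0..<m] ! i)
        (map (\<lambda>i. (B i, B (Suc i))) [0..<n] ! f i)"
    using list_emb_index_map[OF emb] by blast
  have f: "strict_mono_on {..<m} f"
    and fle: "f i < n" "le (A i) (B (f i))" "le (A (Suc i)) (B (Suc (f i)))" if "i < m" for i
    using f fle[of i] that by auto
  define F where "F = (\<lambda>i. case i of 0 \<Rightarrow> 0 | Suc k \<Rightarrow> if k < m then Suc (f k) else Suc n)"
  show ?thesis
  proof
    show "strict_mono_on {..Suc m} F"
      using strict_mono_onD[OF f] fle by (auto simp: strict_mono_on_def F_def split: nat.split)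
    show "le (A i) (B (F i))" if "i \<le> m" for i
      using first fle that by (cases i) (auto simp: F_def)
    show "le (A i) (B (F (Suc i) - 1))" if "i \<le> m" for i
      using last fle that by (cases "i = m") (auto simp: F_def)
  qed (simp_all add: F_def)
qed

theorem good_wqo_on_colored_Reg:
  fixes P :: "('m::{monoid_mult, finite} \<times> 'm \<times> 'm) set"
  assumes ordered: "monoid_totally_ordered TYPE('m)" and "finite X"
  shows "good_wqo_on membeds (colored_Reg P d X)"
proof (induction d)
  case 0
  show ?case using good_wqo_on_colored_Reg_0[OF \<open>finite X\<close>] .
next
  case (Suc d)
  let ?S = "colored_Reg P d X"
  define A where "A = {(G, c :: vname \<Rightarrow> nat). G \<in> {mlg_prod P G1 G2 | G1 G2. G1 \<in> Reg P d \<and> G2 \<in> Reg P d} \<and>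
    c ` mverts G \<subseteq> X}"
  define B where "B = {(G, c :: vname \<Rightarrow> nat). G \<in> {mlg_prod_list P Gs | Gs e. Gs \<noteq> [] \<and> set Gs \<subseteq> Reg P d \<and>
    e * e = e \<and> (\<forall>G\<in>set Gs. meval G = e)} \<and> c ` mverts G \<subseteq> X}"
  have pairs: "good_wqo_on (rel_prod membeds membeds) (?S \<times> ?S)"
    by (intro good_wqo_on_Times Suc transp_membeds)
  have "good_wqo_on membeds A"
  proof (rule good_wqo_on_reduce[OF pairs])
    let ?R = "\<lambda>((G1, c1), (G2, c2)) (G, c).
      G = mlg_prod P G1 G2 \<and> c1 = c \<circ> Cons False \<and> c2 = c \<circ> Cons True"
    show "\<exists>t\<in>?S \<times> ?S. ?R t s" if s: "s \<in> A" for s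
    proof -
      obtain G1 G2 c where "s = (mlg_prod P G1 G2, c)" "G1 \<in> Reg P d" "G2 \<in> Reg P d"
        "c ` mverts (mlg_prod P G1 G2) \<subseteq> X"
        using s unfolding A_def by blast
      then show ?thesis
        by (intro bexI[of _ "((G1, c \<circ> Cons False), (G2, c \<circ> Cons True))"])
          (auto simp: colored_Reg_def mverts_prod)
    qed
    show "membeds s s'" if "?R t s" "?R t' s'" "rel_prod membeds membeds t t'" for t t' s s'
      using that by (auto intro!: membeds_prod simp del: membeds.simps split: prod.splits)
  qed
  moreover have "good_wqo_on membeds B"
  proof (rule good_wqo_on_reduce)
    show "good_wqo_on (rel_prod (rel_prod membeds membeds) (list_emb (rel_prod membeds membeds)))
      ((?S \<times> ?S) \<times> lists (?S \<times> ?S))"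
      by (intro good_wqo_on_Times good_wqo_on_lists Suc transp_rel_prod transp_membeds)
    \<comment> \<open>The first and last factors are stored besides the pairs: they anchor the two
      ends, and they are all that remains when there is a single factor. The idempotent needs no
      entry, being the evaluation of the first factor.\<close>
    let ?codes = "\<lambda>t e Gs \<iota> H C. ordered_idempotent_product P e Gs \<iota> H \<and> Gs \<noteq> [] \<and>
       t = (((Gs ! 0, C \<circ> \<iota> 0), (Gs ! (length Gs - 1), C \<circ> \<iota> (length Gs - 1))),
         map (\<lambda>i. ((Gs ! i, C \<circ> \<iota> i), (Gs ! Suc i, C \<circ> \<iota> (Suc i)))) [0..<length Gs - 1])"
    let ?R = "\<lambda>t (H, C). \<exists>e Gs \<iota>. ?codes t e Gs \<iota> H C"
    show "\<exists>t\<in>(?S \<times> ?S) \<times> lists (?S \<times> ?S). ?R t s" if "s \<in> B" for s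
    proof -
      obtain Gs e C where s: "s = (mlg_prod_list P Gs, C)" and Gs: "Gs \<noteq> []" "set Gs \<subseteq> Reg P d"
        and e: "e * e = e" "\<forall>G\<in>set Gs. meval G = e" and C: "C ` mverts (mlg_prod_list P Gs) \<subseteq> X"
        using \<open>s \<in> B\<close> unfolding B_def by blast
      obtain \<iota> where "idempotent_product P e Gs \<iota> (mlg_prod_list P Gs)"
        using ex_idempotent_product[OF Gs(1) e(1)] Gs(2) e(2) linear_Reg by blast
      then interpret ordered_idempotent_product P e Gs \<iota> "mlg_prod_list P Gs"
        using ordered by (simp add: ordered_idempotent_product_def ordered_idempotent_product_axioms_def)
      have mem: "(Gs ! i, C \<circ> \<iota> i) \<in> ?S" if "i < length Gs" for i
        using that Gs(2) C by (auto simp: colored_Reg_def mverts image_subset_iff)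
      define t where "t = (((Gs ! 0, C \<circ> \<iota> 0), (Gs ! (length Gs - 1), C \<circ> \<iota> (length Gs - 1))),
         map (\<lambda>i. ((Gs ! i, C \<circ> \<iota> i), (Gs ! Suc i, C \<circ> \<iota> (Suc i)))) [0..<length Gs - 1])"
      have "t \<in> (?S \<times> ?S) \<times> lists (?S \<times> ?S)"
        using mem Gs(1) unfolding t_def by (auto simp: in_lists_conv_set)
      moreover have "?codes t e Gs \<iota> (mlg_prod_list P Gs) C"
        using ordered_idempotent_product_axioms Gs(1) by (simp add: t_def)
      ultimately show ?thesis
        unfolding s by blast
    qed
    show "membeds s s'"
      if R: "?R t s" "?R t' s'"
        and le: "rel_prod (rel_prod membeds membeds) (list_emb (rel_prod membeds membeds)) t t'" for t t' s s'
    proof -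
      obtain H C where s: "s = (H, C)" by fastforce
      obtain H' C' where s': "s' = (H', C')" by fastforce
      obtain e Gs \<iota> where 1: "?codes t e Gs \<iota> H C" using R(1) s by auto
      obtain e' Gs' \<iota>' where 2: "?codes t' e' Gs' \<iota>' H' C'" using R(2) s' by auto
      interpret A: ordered_idempotent_product P e Gs \<iota> H using 1 by blast
      interpret B: ordered_idempotent_product P e' Gs' \<iota>' H' using 2 by blast
      let ?A = "\<lambda>i. (Gs ! i, C \<circ> \<iota> i)" and ?B = "\<lambda>i. (Gs' ! i, C' \<circ> \<iota>' i)"
      have first: "membeds (?A 0) (?B 0)"
        and last: "membeds (?A (length Gs - 1)) (?B (length Gs' - 1))"
        and emb: "list_emb (rel_prod membeds membeds)
          (map (\<lambda>i. (?A i, ?A (Suc i))) [0..<length Gs - 1])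
          (map (\<lambda>i. (?B i, ?B (Suc i))) [0..<length Gs' - 1])"
        using 1 2 le by auto
      have n: "Suc (length Gs - 1) = length Gs" "Suc (length Gs' - 1) = length Gs'"
        using 1 2 by auto
      have "e = e'"
        using first A.factors[of 0] B.factors[of 0] 1 2 by auto
      with B.ordered_idempotent_product_axioms
      have B: "ordered_idempotent_product P e Gs' \<iota>' H'" by simp
      obtain F where F: "strict_mono_on {..length Gs} F" "F 0 = 0" "F (length Gs) = length Gs'"
        and FL: "\<And>i. i < length Gs \<Longrightarrow> membeds (?A i) (?B (F i))"
        and FR: "\<And>i. i < length Gs \<Longrightarrow> membeds (?A i) (?B (F (Suc i) - 1))"
        using list_emb_consecutive_pairs[of membeds ?A ?B, OF first last emb]
        unfolding n by (metis less_Suc_eq_le n(1))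
      obtain hL where hL: "\<And>i. i < length Gs \<Longrightarrow>
          is_membedding (hL i) (Gs ! i) (C \<circ> \<iota> i) (Gs' ! F i) (C' \<circ> \<iota>' (F i))"
        using FL by (simp only: membeds.simps) metis
      obtain hR where hR: "\<And>i. i < length Gs \<Longrightarrow> is_membedding (hR i) (Gs ! i) (C \<circ> \<iota> i)
          (Gs' ! (F (Suc i) - 1)) (C' \<circ> \<iota>' (F (Suc i) - 1))"
        using FR by (simp only: membeds.simps) metis
      show ?thesis
        unfolding s s'
        by (rule membeds_idempotent_product[OF A.ordered_idempotent_product_axioms B F hL hR])
    qed
  qed
  moreover have "colored_Reg P (Suc d) X = A \<union> B"
    unfolding colored_Reg_def A_def B_def Reg.simps Un_iff by fast
  ultimately show ?case
    using good_wqo_on_Un by metis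
qed

lemma membeds_imp_lembeds:
  assumes "membeds (G, c) (G', c')" "downcast G = (V, A)" "downcast G' = (V', A')"
  shows "lembeds (V, A, c) (V', A', c')"
proof -
  obtain h where h: "is_membedding h G c G' c'" using assms(1) by auto
  show ?thesis
    using h is_membeddingD[OF h] assms(2,3)
    unfolding lembeds_def by (auto simp: downcast_def is_membedding_def intro!: exI[of _ h])
qed

theorem inf_wqo_Reg:
  fixes P :: "('m::{monoid_mult, finite} \<times> 'm \<times> 'm) set"
  assumes "monoid_totally_ordered TYPE('m)"
  shows "inf_wqo (downcast ` Reg P d)"
  unfolding inf_wqo_def
proof (intro allI impI)
  fix X :: "nat set" assume "finite X"
  show "good_wqo_on lembeds (labellings (downcast ` Reg P d) X)"
  proof (rule good_wqo_on_reduce[OF good_wqo_on_colored_Reg[OF assms \<open>finite X\<close>, of P d]])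
    let ?R = "\<lambda>(G :: 'm mlgraph, c) (V, A, c'). downcast G = (V, A) \<and> c' = c"
    show "\<exists>t\<in>colored_Reg P d X. ?R t s" if s: "s \<in> labellings (downcast ` Reg P d) X" for s
    proof -
      obtain G c where "G \<in> Reg P d" "s = (fst (downcast G), snd (downcast G), c)"
        "c ` fst (downcast G) \<subseteq> X"
        using s unfolding labellings_def by (auto simp: image_iff) (metis fst_conv snd_conv)
      then show ?thesis
        by (intro bexI[of _ "(G, c)"]) (auto simp: colored_Reg_def downcast_def)
    qed
    show "lembeds s s'" if "?R t s" "?R t' s'" "membeds t t'" for t t' s s'
      using that by (auto intro: membeds_imp_lembeds simp del: membeds.simps split: prod.splits)
  qed
qed

section \<open>Antichains over monoids that are not totally ordered\<close>

definition middle_selector :: "'m set \<Rightarrow> ('m \<times> 'm \<times> 'm) set" where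
  "middle_selector S = UNIV \<times> S \<times> UNIV"

text \<open>The vertices of \<open>G\<close> sit at the gaps of the word \<open>w\<close>; several vertices may share a gap,
  which is what pads a word to the length of a complete binary product.\<close>
definition on_word :: "'m::monoid_mult set \<Rightarrow> 'm mlgraph \<Rightarrow> (vname \<Rightarrow> nat) \<Rightarrow> 'm list \<Rightarrow> bool" where
  "on_word S G p w \<longleftrightarrow> meval G = prod_list w \<and>
     p ` mverts G \<subseteq> {..length w} \<and> {..<length w} \<subseteq> p ` mverts G \<and>
     (\<forall>v\<in>mverts G. mlab G v = (prod_list (take (p v) w), prod_list (drop (p v) w))) \<and>
     (\<forall>u\<in>mverts G. \<forall>v\<in>mverts G. u \<noteq> v \<longrightarrow> p u \<le> p v \<longrightarrow> (\<forall>s t.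
        (medge G u v s t \<longleftrightarrow> prod_list (drop (p u) (take (p v) w)) \<in> S) \<and>
        (medge G v u s t \<longleftrightarrow> prod_list (drop (p u) (take (p v) w)) \<in> S)))"

lemma on_wordD:
  assumes "on_word S G p w"
  shows "meval G = prod_list w" "v \<in> mverts G \<Longrightarrow> p v \<le> length w"
    "i < length w \<Longrightarrow> i \<in> p ` mverts G"
    "v \<in> mverts G \<Longrightarrow> mlab G v = (prod_list (take (p v) w), prod_list (drop (p v) w))"
    "u \<in> mverts G \<Longrightarrow> v \<in> mverts G \<Longrightarrow> u \<noteq> v \<Longrightarrow> p u \<le> p v \<Longrightarrow>
      medge G u v s t \<longleftrightarrow> prod_list (drop (p u) (take (p v) w)) \<in> S"
    "u \<in> mverts G \<Longrightarrow> v \<in> mverts G \<Longrightarrow> u \<noteq> v \<Longrightarrow> p u \<le> p v \<Longrightarrow>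
      medge G v u s t \<longleftrightarrow> prod_list (drop (p u) (take (p v) w)) \<in> S"
proof -
  show "v \<in> mverts G \<Longrightarrow> p v \<le> length w" "i < length w \<Longrightarrow> i \<in> p ` mverts G"
    using assms unfolding on_word_def by auto
qed (use assms in \<open>simp_all add: on_word_def\<close>)

lemma on_word_prod:
  assumes 1: "on_word S G1 p1 w1" and 2: "on_word S G2 p2 w2"
  shows "on_word S (mlg_prod (middle_selector S) G1 G2)
    (\<lambda>u. if hd u then length w1 + p2 (tl u) else p1 (tl u)) (w1 @ w2)"
    (is "on_word S ?G ?p ?w")
  unfolding on_word_def
proof (intro conjI ballI allI impI)
  show "?p ` mverts ?G \<subseteq> {..length ?w}"
    using on_wordD(2)[OF 1] on_wordD(2)[OF 2] by (auto simp: mverts_prod intro: trans_le_add1)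
  show "{..<length ?w} \<subseteq> ?p ` mverts ?G"
  proof
    fix i assume i: "i \<in> {..<length ?w}"
    show "i \<in> ?p ` mverts ?G"
    proof (cases "i < length w1")
      case True
      then obtain v where "v \<in> mverts G1" "i = p1 v" using on_wordD(3)[OF 1] by blast
      then show ?thesis by (intro image_eqI[of _ _ "False # v"]) (auto simp: mverts_prod)
    next
      case False
      then have "i - length w1 < length w2" using i by auto
      then obtain v where "v \<in> mverts G2" "i - length w1 = p2 v" using on_wordD(3)[OF 2] by blast
      then show ?thesis using False by (intro image_eqI[of _ _ "True # v"]) (auto simp: mverts_prod)
    qed
  qed
  show "mlab ?G v = (prod_list (take (?p v) ?w), prod_list (drop (?p v) ?w))" if "v \<in> mverts ?G" for v
    using that on_wordD(1,2,4)[OF 1] on_wordD(1,2,4)[OF 2] by (auto simp: mverts_prod)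
  fix u v s t assume uv: "u \<in> mverts ?G" "v \<in> mverts ?G" "u \<noteq> v" "?p u \<le> ?p v"
  have "(medge ?G u v s t \<longleftrightarrow> prod_list (drop (?p u) (take (?p v) ?w)) \<in> S) \<and>
    (medge ?G v u s t \<longleftrightarrow> prod_list (drop (?p u) (take (?p v) ?w)) \<in> S)"
  proof -
    consider u' v' where "u = False # u'" "v = False # v'" "u' \<in> mverts G1" "v' \<in> mverts G1"
      | u' v' where "u = True # u'" "v = True # v'" "u' \<in> mverts G2" "v' \<in> mverts G2"
      | u' v' where "u = False # u'" "v = True # v'" "u' \<in> mverts G1" "v' \<in> mverts G2"
      | u' v' where "u = True # u'" "v = False # v'" "u' \<in> mverts G2" "v' \<in> mverts G1"
      using uv(1,2) unfolding mverts_prod by blast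
    then show ?thesis
    proof cases
      case 1
      then show ?thesis
        using uv on_wordD(2)[OF assms(1)] by (simp add: on_wordD(5,6)[OF assms(1)])
    next
      case 2
      then show ?thesis
        using uv by (simp add: on_wordD(5,6)[OF assms(2)])
    next
      case 3
      then show ?thesis
        using on_wordD(2,4)[OF assms(1), of u'] on_wordD(4)[OF assms(2), of v']
        by (simp add: middle_selector_def)
    next
      case 4
      \<comment> \<open>A vertex of the right factor is not beyond one of the left factor only if
        both sit at the junction; the segment between them is then empty.\<close>
      then have "p2 u' = 0" "p1 v' = length w1"
        using uv(4) on_wordD(2)[OF assms(1), of v'] by auto
      then show ?thesis
        using 4 on_wordD(4)[OF assms(1), of v'] on_wordD(4)[OF assms(2), of u']
        by (simp add: middle_selector_def)
    qed
  qed
  then show "medge ?G u v s t \<longleftrightarrow> prod_list (drop (?p u) (take (?p v) ?w)) \<in> S"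
    "medge ?G v u s t \<longleftrightarrow> prod_list (drop (?p u) (take (?p v) ?w)) \<in> S"
    by simp_all
qed (simp add: on_wordD(1)[OF 1] on_wordD(1)[OF 2])

lemma ex_Reg_on_word:
  "length w \<le> 2 ^ k \<Longrightarrow> \<exists>G\<in>Reg (middle_selector S) k. \<exists>p. on_word S G p w"
proof (induction k arbitrary: w)
  case 0
  \<comment> \<open>The vertex stands before its letter, so a leaf leaves the gap after the letter
    vacant. Leaves for the empty word, which pad the product, fall on the final gap of the
    word.\<close>
  let ?G = "\<lparr>meval = prod_list w, mverts = {[]}, medge = \<lambda>_ _ _ _. False, mlab = \<lambda>_. (1, prod_list w)\<rparr>"
  have "w = [] \<or> length w = 1" using 0 by (cases w) auto
  then have "on_word S ?G (\<lambda>_. 0) w" by (auto simp: on_word_def)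
  moreover have "?G \<in> Reg (middle_selector S) 0" by (simp add: mlg_wf_def)
  ultimately show ?case by blast
next
  case (Suc k)
  obtain G1 p1 where 1: "G1 \<in> Reg (middle_selector S) k" "on_word S G1 p1 (take (2 ^ k) w)"
    using Suc.IH[of "take (2 ^ k) w"] by auto
  obtain G2 p2 where 2: "G2 \<in> Reg (middle_selector S) k" "on_word S G2 p2 (drop (2 ^ k) w)"
  proof -
    have "length (drop (2 ^ k) w) \<le> 2 ^ k" using Suc.prems by simp
    then show ?thesis using Suc.IH that by blast
  qed
  have "mlg_prod (middle_selector S) G1 G2 \<in> Reg (middle_selector S) (Suc k)"
    using 1 2 by auto
  moreover have "\<exists>p. on_word S (mlg_prod (middle_selector S) G1 G2) p w"
    using on_word_prod[OF 1(2) 2(2)] by auto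
  ultimately show ?case by blast
qed

lemma on_word_replicate:
  assumes "on_word S G p w"
  shows "\<exists>q. on_word S (mlg_prod_list (middle_selector S) (replicate (Suc n) G)) q
    (concat (replicate (Suc n) w))"
proof (induction n)
  case 0
  then show ?case using assms by auto
next
  case (Suc n)
  then obtain q where q: "on_word S (mlg_prod_list (middle_selector S) (replicate (Suc n) G)) q
    (concat (replicate (Suc n) w))" by blast
  have G: "replicate (Suc (Suc n)) G = replicate (Suc n) G @ [G]"
    and w: "replicate (Suc (Suc n)) w = replicate (Suc n) w @ [w]"
    by (simp_all add: replicate_append_same)
  show ?case
    using on_word_prod[OF q assms] unfolding G w by (subst mlg_prod_list_snoc) auto
qed

lemma not_totally_ordered_witness:
  assumes "\<not> monoid_totally_ordered TYPE('m::monoid_mult)"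
  obtains x y c :: "'m::monoid_mult" where "x \<notin> Jideal c" "y \<notin> Jideal c" "x * y \<in> Jideal c" "y * x \<in> Jideal c"
proof -
  obtain a b :: 'm where "Jideal (a * b) \<noteq> Jideal a" "Jideal (a * b) \<noteq> Jideal b"
    using assms unfolding monoid_totally_ordered_def by blast
  moreover have "Jideal (a * b) \<subseteq> Jideal a" "Jideal (a * b) \<subseteq> Jideal b"
    by (simp_all add: Jideal_subset Jideal_mult_left Jideal_mult_right Jideal_self)
  ultimately have ab: "a \<notin> Jideal (a * b)" "b \<notin> Jideal (a * b)"
    using Jideal_subset by blast+
  \<comment> \<open>If \<open>b * a\<close> lies outside the ideal of \<open>a * b\<close>, both
    witnesses are \<open>b * a\<close>, whose square is \<open>b * (a * b) * a\<close>; otherwise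
    \<open>a\<close> and \<open>b\<close> themselves serve.\<close>
  have "b * a * (b * a) \<in> Jideal (a * b)"
    using Jideal_mult[OF Jideal_self, of b "a * b" a] by (simp add: mult.assoc)
  then show ?thesis
    using that[of "b * a" "a * b" "b * a"] that[of a "a * b" b] ab Jideal_self by blast
qed

section \<open>The alternating word and paths with marked ends\<close>

lemma nth_concat_replicate_pair:
  "i < 2 * n \<Longrightarrow> concat (replicate n [x, y]) ! i = (if even i then x else y)"
proof (induction n arbitrary: i)
  case (Suc n)
  consider "i = 0" | "i = 1" | j where "i = Suc (Suc j)"
    by (metis One_nat_def not0_implies_Suc)
  then show ?case using Suc by cases auto
qed simp

lemma length_concat_replicate: "length (concat (replicate n xs)) = n * length xs"
  by (simp add: length_concat sum_list_replicate)

lemma concat_replicate_concat_replicate: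
  "concat (replicate m (concat (replicate n xs))) = concat (replicate (m * n) xs)"
  by (induction m) (simp_all add: replicate_add)

definition adjacent :: "nat \<Rightarrow> nat \<Rightarrow> bool" where
  "adjacent m n \<longleftrightarrow> n = Suc m \<or> m = Suc n"

lemma segment_mem_iff:
  fixes x y c :: "'m::monoid_mult"
  assumes I: "x \<notin> Jideal c" "y \<notin> Jideal c" "x * y \<in> Jideal c" "y * x \<in> Jideal c"
    and ij: "i \<le> j" "j \<le> 2 * n"
  shows "prod_list (drop i (take j (concat (replicate n [x, y])))) \<in> {x, y} \<longleftrightarrow> j = Suc i"
proof -
  let ?w = "concat (replicate n [x, y])"
  have nth: "?w ! k = (if even k then x else y)" if "k < j" for k
    using nth_concat_replicate_pair[of k n x y] that ij by simp
  have len: "length ?w = 2 * n" by (simp add: length_concat_replicate)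
  have split: "drop k (take j ?w) = (if even k then x else y) # drop (Suc k) (take j ?w)" if "k < j" for k
    using Cons_nth_drop_Suc[of k "take j ?w"] that len ij nth[OF that] by simp
  consider "j = i" | "j = Suc i" | "Suc i < j" using ij by linarith
  then show ?thesis
  proof cases
    case 1
    \<comment> \<open>If one of the letters were 1, then \<open>x * y\<close> would be the other
      letter, which lies outside the ideal.\<close>
    have "1 \<noteq> x" "1 \<noteq> y" using I by (metis mult_1_left)+
    then show ?thesis using 1 by auto
  next
    case 2
    then show ?thesis using split[of i] by auto
  next
    case 3
    have "prod_list (drop i (take j ?w)) \<in> Jideal c"
      using split[of i] split[of "Suc i"] 3 I
      by (auto simp: mult.assoc[symmetric] intro: Jideal_mult_right)
    then show ?thesis using 3 I by auto
  qed
qed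

text \<open>No injectivity is available, so folding back must be excluded. At \<open>t = 2\<close> a
  fold would hit the marked end 0. At \<open>t = u + 3\<close> it would hit \<open>u + 1\<close>, a
  neighbour of \<open>f u = u\<close>, although \<open>t\<close> and \<open>u\<close> are not
  adjacent.\<close>

lemma path_map_fixed:
  assumes adj: "\<And>s t. s \<le> K \<Longrightarrow> t \<le> K \<Longrightarrow> adjacent (f s) (f t) \<longleftrightarrow> adjacent s t"
    and ends: "\<And>t. t \<le> K \<Longrightarrow> f t \<in> {0, K'} \<longleftrightarrow> t \<in> {0, K}"
    and "3 \<le> K" "f 0 = 0" "t \<le> K"
  shows "f t = t"
  using \<open>t \<le> K\<close>
proof (induction t rule: less_induct)
  case (less t)
  consider "t = 0" | "t = 1" | "t = 2" | u where "t = Suc (Suc (Suc u))"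
    by (metis One_nat_def Suc_1 not0_implies_Suc)
  then show ?case
  proof cases
    case 1
    then show ?thesis using \<open>f 0 = 0\<close> by simp
  next
    case 2
    then show ?thesis using adj[of 0 1] \<open>3 \<le> K\<close> \<open>f 0 = 0\<close> by (simp add: adjacent_def)
  next
    case 3
    then show ?thesis using adj[of 1 2] ends[of 2] less.IH[of 1] \<open>3 \<le> K\<close> by (auto simp: adjacent_def)
  next
    case (4 u)
    then show ?thesis
      using adj[of "Suc (Suc u)" t] adj[of u t] less.IH[of u] less.IH[of "Suc (Suc u)"] less.prems
      by (auto simp: adjacent_def)
  qed
qed

lemma no_path_map:
  assumes adj: "\<And>s t. s \<le> K \<Longrightarrow> t \<le> K \<Longrightarrow> adjacent (f s) (f t) \<longleftrightarrow> adjacent s t"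
    and ends: "\<And>t. t \<le> K \<Longrightarrow> f t \<in> {0, K'} \<longleftrightarrow> t \<in> {0, K}"
    and bound: "\<And>t. t \<le> K \<Longrightarrow> f t \<le> K'"
    and K: "3 \<le> K" "K < K'"
  shows False
proof -
  consider "f 0 = 0" | "f 0 = K'" using ends[of 0] by auto
  then show False
  proof cases
    case 1
    then have "f K = K" using path_map_fixed[OF adj ends] K by blast
    then show False using ends[of K] K by auto
  next
    case 2
    \<comment> \<open>Reading the target path backwards reduces this case to a map that fixes
      0.\<close>
    let ?g = "\<lambda>t. K' - f t"
    have "?g K = K"
    proof (rule path_map_fixed)
      show "adjacent (?g s) (?g t) \<longleftrightarrow> adjacent s t" if "s \<le> K" "t \<le> K" for s t
        using adj[OF that] bound[OF that(1)] bound[OF that(2)] by (auto simp: adjacent_def)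
      show "?g t \<in> {0, K'} \<longleftrightarrow> t \<in> {0, K}" if "t \<le> K" for t
        using ends[OF that] bound[OF that] K by auto
    qed (use 2 K in auto)
    then show False using ends[of K] bound[of K] K by auto
  qed
qed

text \<open>Choosing one vertex per gap turns an embedding of blown-up paths with marked ends into a
  map between paths.\<close>
lemma not_lembeds_blown_up_paths:
  assumes G: "p ` V = {..K}" "\<And>u v. u \<in> V \<Longrightarrow> v \<in> V \<Longrightarrow> A u v \<longleftrightarrow> adjacent (p u) (p v)"
    and G': "p' ` V' = {..K'}" "\<And>u v. u \<in> V' \<Longrightarrow> v \<in> V' \<Longrightarrow> A' u v \<longleftrightarrow> adjacent (p' u) (p' v)"
    and K: "3 \<le> K" "K < K'"
  shows "\<not> lembeds (V, A, \<lambda>v. of_bool (p v \<in> {0, K})) (V', A', \<lambda>v. of_bool (p' v \<in> {0, K'}))"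
proof
  assume "lembeds (V, A, \<lambda>v. of_bool (p v \<in> {0, K})) (V', A', \<lambda>v. of_bool (p' v \<in> {0, K'}))"
  then obtain h where h: "h ` V \<subseteq> V'" "\<And>u v. u \<in> V \<Longrightarrow> v \<in> V \<Longrightarrow> A' (h u) (h v) \<longleftrightarrow> A u v"
    "\<And>v. v \<in> V \<Longrightarrow> (of_bool (p' (h v) \<in> {0, K'}) :: nat) = of_bool (p v \<in> {0, K})"
    unfolding lembeds_def by auto
  define q where "q = inv_into V p"
  have q: "q t \<in> V" "p (q t) = t" if "t \<le> K" for t
    using that G(1) inv_into_into[of t p V] f_inv_into_f[of t p V] by (simp_all add: q_def)
  have hq: "h (q t) \<in> V'" if "t \<le> K" for t using q(1)[OF that] h(1) by blast
  show False
  proof (rule no_path_map[OF _ _ _ K])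
    show "adjacent (p' (h (q s))) (p' (h (q t))) \<longleftrightarrow> adjacent s t" if "s \<le> K" "t \<le> K" for s t
      using h(2)[OF q(1) q(1), OF that] G(2)[OF q(1) q(1), OF that] G'(2)[OF hq hq, OF that] q(2) that
      by simp
    show "p' (h (q t)) \<in> {0, K'} \<longleftrightarrow> t \<in> {0, K}" if "t \<le> K" for t
      using h(3)[OF q(1)[OF that]] q(2)[OF that] by (simp only: of_bool_eq_iff)
    show "p' (h (q t)) \<le> K'" if "t \<le> K" for t
      using hq[OF that] G'(1) by auto
  qed
qed

section \<open>The antichain with two colours\<close>

theorem not_k_wqo_2_Reg:
  assumes "\<not> monoid_totally_ordered TYPE('m::{monoid_mult, finite})"
  shows "\<exists>(P :: ('m \<times> 'm \<times> 'm) set) d. \<not> k_wqo 2 (downcast ` Reg P d)"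
proof -
  obtain x y c :: 'm where I: "x \<notin> Jideal c" "y \<notin> Jideal c" "x * y \<in> Jideal c" "y * x \<in> Jideal c"
    using not_totally_ordered_witness[OF assms] .
  let ?P = "middle_selector {x, y}"
  obtain N where N: "N > 0" "(x * y) ^ N * (x * y) ^ N = (x * y) ^ N"
    by (rule ex_idempotent_power)
  define w where "w = concat (replicate N [x, y])"
  have w: "prod_list w = (x * y) ^ N"
    unfolding w_def by (induction N) (simp_all add: mult.assoc)
  obtain k where "length w \<le> 2 ^ k"
    using less_exp less_imp_le by blast
  then obtain G p where G: "G \<in> Reg ?P k" "on_word {x, y} G p w"
    using ex_Reg_on_word by blast
  \<comment> \<open>Using at least two blocks makes the word have length at least 4, so even a path
    missing its last gap meets the bound 3 of the path lemmas.\<close>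
  define H where "H = (\<lambda>n. mlg_prod_list ?P (replicate (Suc (Suc n)) G))"
  define L where "L = (\<lambda>n. 2 * (Suc (Suc n) * N))"
  have HReg: "H n \<in> Reg ?P (Suc k)" for n
  proof -
    have "\<forall>G'\<in>set (replicate (Suc (Suc n)) G). meval G' = (x * y) ^ N"
      using on_wordD(1)[OF G(2)] w by simp
    moreover have "set (replicate (Suc (Suc n)) G) \<subseteq> Reg ?P k" "replicate (Suc (Suc n)) G \<noteq> []"
      using G(1) by auto
    ultimately show ?thesis
      unfolding H_def Reg.simps using N(2) by blast
  qed
  have "\<exists>p. on_word {x, y} (H n) p (concat (replicate (Suc (Suc n) * N) [x, y]))" for n
    using on_word_replicate[OF G(2), of "Suc n"]
    unfolding H_def w_def concat_replicate_concat_replicate .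
  then obtain p where p: "\<And>n. on_word {x, y} (H n) (p n) (concat (replicate (Suc (Suc n) * N) [x, y]))"
    by metis
  have len: "length (concat (replicate (Suc (Suc n) * N) [x, y])) = L n" for n
    unfolding length_concat_replicate L_def by simp
  have edge: "snd (downcast (H n)) u v \<longleftrightarrow> adjacent (p n u) (p n v)"
    if uv: "u \<in> mverts (H n)" "v \<in> mverts (H n)" for n u v
  proof (cases "u = v")
    case False
    have "p n u \<le> L n" "p n v \<le> L n"
      using on_wordD(2)[OF p, of _ n] uv len by auto
    then show ?thesis
      using on_wordD(5)[OF p uv False, of 1 1] on_wordD(6)[OF p uv(2,1), of 1 1] False
        segment_mem_iff[OF I, of "p n u" "p n v" "Suc (Suc n) * N"]
        segment_mem_iff[OF I, of "p n v" "p n u" "Suc (Suc n) * N"]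
      by (cases "p n u \<le> p n v") (auto simp: downcast_def adjacent_def L_def)
  qed (simp add: downcast_def adjacent_def)
  \<comment> \<open>Whether the final gap is occupied depends on the padding of the last block, so
    the path ends at \<open>L n\<close> or at \<open>L n - 1\<close>. Since \<open>L\<close> grows
    by at least 2, \<open>K\<close> is strictly increasing in either case.\<close>
  define K where "K = (\<lambda>n. if L n \<in> p n ` mverts (H n) then L n else L n - 1)"
  have L: "4 \<le> L n" "m < n \<Longrightarrow> L m + 2 \<le> L n" for m n
  proof -
    show "4 \<le> L n" using N(1) by (cases N) (auto simp: L_def)
    assume "m < n"
    then have "Suc (Suc m) * N + N \<le> Suc (Suc n) * N"
      using mult_le_mono1[of "Suc (Suc (Suc m))" "Suc (Suc n)" N] by simp
    then show "L m + 2 \<le> L n" using N(1) by (simp add: L_def)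
  qed
  have range: "p n ` mverts (H n) = {..K n}" for n
  proof -
    have "p n ` mverts (H n) \<subseteq> {..L n}" "{..<L n} \<subseteq> p n ` mverts (H n)"
      using p[of n] len[of n] unfolding on_word_def by simp_all
    moreover have "{..L n} = insert (L n) {..<L n}" by auto
    moreover have "{..L n - 1} = {..<L n}" using L(1)[of n] by auto
    ultimately have "p n ` mverts (H n) =
        (if L n \<in> p n ` mverts (H n) then {..L n} else {..L n - 1})"
      by (metis insert_absorb2 subset_antisym subset_insert insert_subset)
    then show ?thesis unfolding K_def by (metis (full_types))
  qed
  have K: "3 \<le> K n" "m < n \<Longrightarrow> K m < K n" for m n
  proof -
    have KL: "K i \<le> L i \<and> L i \<le> Suc (K i)" for i unfolding K_def by simp arith
    show "3 \<le> K n" using KL[of n] L(1)[of n] by linarith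
    show "K m < K n" if "m < n" using KL[of n] KL[of m] L(2)[OF that] by linarith
  qed
  define col where "col = (\<lambda>n v. of_bool (p n v \<in> {0, K n}) :: nat)"
  define F where "F = (\<lambda>n. (mverts (H n), snd (downcast (H n)), col n))"
  have "\<not> k_wqo 2 (downcast ` Reg ?P (Suc k))"
  proof
    assume "k_wqo 2 (downcast ` Reg ?P (Suc k))"
    then have "good_wqo_on lembeds (labellings (downcast ` Reg ?P (Suc k)) {0, 1})"
      unfolding k_wqo_def by simp
    moreover have "F n \<in> labellings (downcast ` Reg ?P (Suc k)) {0, 1}" for n
      using HReg[of n] by (auto simp: F_def labellings_def downcast_def col_def)
    ultimately obtain i j where ij: "i < j" "lembeds (F i) (F j)"
      using good_wqo_onD by blast
    then show False
      using not_lembeds_blown_up_paths[OF range edge range edge K(1) K(2)[OF ij(1)]]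
      unfolding F_def col_def by blast
  qed
  then show ?thesis by blast
qed

theorem theorem4p6:
  fixes T :: "('m::{monoid_mult, finite}) itself"
  shows "(monoid_totally_ordered T \<longleftrightarrow>
           (\<forall>(P :: ('m \<times> 'm \<times> 'm) set) d. inf_wqo (downcast ` Reg P d)))
       \<and> (monoid_totally_ordered T \<longleftrightarrow>
           (\<forall>(P :: ('m \<times> 'm \<times> 'm) set) d. k_wqo 2 (downcast ` Reg P d)))"
proof -
  have T: "monoid_totally_ordered T \<longleftrightarrow> monoid_totally_ordered TYPE('m)"
    by (simp add: monoid_totally_ordered_def)
  \<comment> \<open>This closes the cycle: the forward direction yields the stronger property, and
    the converse refutes the weaker one.\<close>
  have "k_wqo 2 C" if "inf_wqo C" for C
    using that unfolding inf_wqo_def k_wqo_def by blast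
  then show ?thesis
    using inf_wqo_Reg not_k_wqo_2_Reg unfolding T by blast
qed

end
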